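(* Let $(V,\tau)$ be a complete topological vector space and let $q$ be a quadratic form on $V$. Assume that $(D(q),\tau_q)$ is metrizable. Then each two of the following assertions imply the third. (i) $q$ is closed. (ii) The kernel $\ker q$ is $\tau$-closed and the canonical embedding $(D(q)/\ker q,\,q)\to (V/\ker q,\,\tau/\ker q)$, $u+\ker q\mapsto u+\ker q$, is continuous. (iii) $(D(q)/\ker q,\,q)$ is a Hilbert space.
   Context: A quadratic form on a real vector space $V$ is a map $q:V\to[0,\infty]$ with $2q(u)+2q(v)=q(u+v)+q(u-v)$ and $q(\lambda u)=|\lambda|^2q(u)$ for all $u,v\in V$, $\lambda\in\mathbb R$ (convention $0\cdot\infty=0$). Its domain is $D(q)=\{u: q(u)<\infty\}$, its kernel is $\ker q=\{u:q(u)=0\}$, and $q(u,v)=\frac14(q(u+v)-q(u-v))$ is a bilinear form on $D(q)$ which induces an inner product (again denoted $q$) on $D(q)/\ker q$. With $\|u\|_q=\sqrt{q(u)}$, the form topology $\tau_q$ on $D(q)$ is the smallest topology containing both the subspace topology of $\tau$ and the topology generated by the seminorm $\|\cdot\|_q$. The form $q$ is closed if $(D(q),\tau_q)$ is complete. $\tau/\ker q$ denotes the quotient topology on $V/\ker q$; $D(q)/\ker q$ in (ii) carries the topology of the inner product $q$. Topological vector spaces are real and Hausdorff. *)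

theory Defs
  imports "HOL-Analysis.Analysis"
begin

section \<open>Real topological vector spaces with an explicit topology\<close>

text \<open>The vector space is the type of class \<^class>\<open>real_vector\<close>; its topology is a separate
  argument, because a second (finer) topology on a subspace has to be considered as well.\<close>

definition topological_vector_space :: "'v::real_vector topology \<Rightarrow> bool" where
  "topological_vector_space T \<longleftrightarrow>
     topspace T = UNIV \<and> Hausdorff_space T \<and>
     continuous_map (prod_topology T T) T (\<lambda>(x, y). x + y) \<and>
     continuous_map (prod_topology euclideanreal T) T (\<lambda>(c, x). c *\<^sub>R x)"

text \<open>Completeness with respect to the translation-invariant uniformity, in terms of filters as in
  \<^const>\<open>cauchy_filter\<close> and \<^const>\<open>complete\<close>.  It is used both for topologies on
  the whole space and for linear topologies carried by a linear subspace \<open>topspace T\<close>.\<close>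

definition vector_cauchy_filter :: "'v::real_vector topology \<Rightarrow> 'v filter \<Rightarrow> bool" where
  "vector_cauchy_filter T F \<longleftrightarrow>
     (\<forall>U. openin T U \<and> 0 \<in> U \<longrightarrow> (\<forall>\<^sub>F (x, y) in F \<times>\<^sub>F F. x - y \<in> U))"

definition vector_complete :: "'v::real_vector topology \<Rightarrow> bool" where
  "vector_complete T \<longleftrightarrow>
     (\<forall>F \<le> principal (topspace T). F \<noteq> bot \<longrightarrow> vector_cauchy_filter T F \<longrightarrow>
        (\<exists>l. limitin T (\<lambda>x. x) l F))"


section \<open>Quotients by a linear subspace\<close>

text \<open>The class \<open>u + N\<close> is the set \<open>u +o N\<close>, and the sum of two classes is their elementwise sum
  \<^term>\<open>A + B\<close>. Adding \<open>N\<close> in the scalar multiple only matters for the scalar \<open>0\<close>,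
  where the elementwise multiple would be \<open>{0}\<close> instead of \<open>N\<close>.\<close>

definition quotient_set :: "'v::real_vector set \<Rightarrow> 'v set \<Rightarrow> 'v set set" where
  "quotient_set S N = (\<lambda>u. u +o N) ` S"

definition coset_scaleR :: "'v::real_vector set \<Rightarrow> real \<Rightarrow> 'v set \<Rightarrow> 'v set" where
  "coset_scaleR N c A = (\<lambda>a. c *\<^sub>R a) ` A + N"

definition quotient_topology :: "'v::real_vector topology \<Rightarrow> 'v set \<Rightarrow> 'v set topology" where
  "quotient_topology T N =
     topology (\<lambda>\<U>. \<U> \<subseteq> quotient_set (topspace T) N \<and>
                    openin T {u \<in> topspace T. u +o N \<in> \<U>})"

lemma openin_quotient_topology:
  "openin (quotient_topology T N) \<U> \<longleftrightarrow>
     \<U> \<subseteq> quotient_set (topspace T) N \<and> openin T {u \<in> topspace T. u +o N \<in> \<U>}"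
proof -
  let ?P = "\<lambda>\<U>. \<U> \<subseteq> quotient_set (topspace T) N \<and> openin T {u \<in> topspace T. u +o N \<in> \<U>}"
  have "istopology ?P"
    unfolding istopology_def
  proof (intro conjI allI impI)
    fix A B assume A: "?P A" and B: "?P B"
    then show "A \<inter> B \<subseteq> quotient_set (topspace T) N" by blast
    have "{u \<in> topspace T. u +o N \<in> A \<inter> B} =
        {u \<in> topspace T. u +o N \<in> A} \<inter> {u \<in> topspace T. u +o N \<in> B}" by blast
    with A B show "openin T {u \<in> topspace T. u +o N \<in> A \<inter> B}" by (simp add: openin_Int)
  next
    fix K assume K: "\<forall>A\<in>K. ?P A"
    then show "\<Union>K \<subseteq> quotient_set (topspace T) N" by blast
    have "{u \<in> topspace T. u +o N \<in> \<Union>K} = (\<Union>A\<in>K. {u \<in> topspace T. u +o N \<in> A})" by blast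
    with K show "openin T {u \<in> topspace T. u +o N \<in> \<Union>K}" by auto
  qed
  then show ?thesis
    unfolding quotient_topology_def by (simp add: topology_inverse')
qed

lemma topspace_quotient_topology:
  "topspace (quotient_topology T N) = quotient_set (topspace T) N"
proof -
  have "{u \<in> topspace T. u +o N \<in> quotient_set (topspace T) N} = topspace T"
    by (auto simp: quotient_set_def)
  then have "openin (quotient_topology T N) (quotient_set (topspace T) N)"
    by (simp add: openin_quotient_topology)
  then show ?thesis
    by (metis openin_quotient_topology openin_subset openin_topspace subset_antisym)
qed

lemma quotient_map_quotient_topology:
  "quotient_map T (quotient_topology T N) (\<lambda>u. u +o N)"
  by (auto simp: quotient_map_def topspace_quotient_topology openin_quotient_topology
      quotient_set_def)


section \<open>Real inner product spaces and Hilbert spaces on a carrier set\<close>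

locale real_inner_space_on =
  fixes S :: "'a set"
    and add :: "'a \<Rightarrow> 'a \<Rightarrow> 'a"
    and zero :: 'a
    and scal :: "real \<Rightarrow> 'a \<Rightarrow> 'a"
    and ip :: "'a \<Rightarrow> 'a \<Rightarrow> real"
  assumes add_closed: "x \<in> S \<Longrightarrow> y \<in> S \<Longrightarrow> add x y \<in> S"
    and zero_closed: "zero \<in> S"
    and scal_closed: "x \<in> S \<Longrightarrow> scal c x \<in> S"
    and add_assoc: "x \<in> S \<Longrightarrow> y \<in> S \<Longrightarrow> z \<in> S \<Longrightarrow> add (add x y) z = add x (add y z)"
    and add_commute: "x \<in> S \<Longrightarrow> y \<in> S \<Longrightarrow> add x y = add y x"
    and add_zero: "x \<in> S \<Longrightarrow> add x zero = x"
    and add_inverse: "x \<in> S \<Longrightarrow> add x (scal (- 1) x) = zero"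
    and scal_add: "x \<in> S \<Longrightarrow> y \<in> S \<Longrightarrow> scal c (add x y) = add (scal c x) (scal c y)"
    and add_scal: "x \<in> S \<Longrightarrow> scal (c + d) x = add (scal c x) (scal d x)"
    and scal_scal: "x \<in> S \<Longrightarrow> scal c (scal d x) = scal (c * d) x"
    and scal_one: "x \<in> S \<Longrightarrow> scal 1 x = x"
    and ip_commute: "x \<in> S \<Longrightarrow> y \<in> S \<Longrightarrow> ip x y = ip y x"
    and ip_add: "x \<in> S \<Longrightarrow> y \<in> S \<Longrightarrow> z \<in> S \<Longrightarrow> ip (add x y) z = ip x z + ip y z"
    and ip_scal: "x \<in> S \<Longrightarrow> y \<in> S \<Longrightarrow> ip (scal c x) y = c * ip x y"
    and ip_nonneg: "x \<in> S \<Longrightarrow> 0 \<le> ip x x"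
    and ip_eq_0: "x \<in> S \<Longrightarrow> ip x x = 0 \<Longrightarrow> x = zero"

text \<open>The value off \<open>S\<close> is chosen such that \<^locale>\<open>Metric_space\<close>, which asks for symmetry
  and nonnegativity on the whole type, is satisfied.\<close>

definition ip_dist ::
  "'a set \<Rightarrow> ('a \<Rightarrow> 'a \<Rightarrow> 'a) \<Rightarrow> (real \<Rightarrow> 'a \<Rightarrow> 'a) \<Rightarrow> ('a \<Rightarrow> 'a \<Rightarrow> real) \<Rightarrow> 'a \<Rightarrow> 'a \<Rightarrow> real" where
  "ip_dist S add scal ip x y =
     (if x \<in> S \<and> y \<in> S
      then sqrt (ip (add x (scal (- 1) y)) (add x (scal (- 1) y))) else 0)"

locale real_hilbert_space_on = real_inner_space_on S add zero scal ip
  for S :: "'a set" and add zero scal ip +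
  assumes complete: "Metric_space.mcomplete S (ip_dist S add scal ip)"


section \<open>Quadratic forms\<close>

text \<open>In \<^typ>\<open>ennreal\<close> one has \<open>0 * \<infinity> = 0\<close>.\<close>

definition quadratic_form :: "('v::real_vector \<Rightarrow> ennreal) \<Rightarrow> bool" where
  "quadratic_form q \<longleftrightarrow>
     (\<forall>u v. 2 * q u + 2 * q v = q (u + v) + q (u - v)) \<and>
     (\<forall>c u. q (c *\<^sub>R u) = ennreal (\<bar>c\<bar>\<^sup>2) * q u)"

definition form_domain :: "('v \<Rightarrow> ennreal) \<Rightarrow> 'v set" where
  "form_domain q = {u. q u < \<infinity>}"

definition form_kernel :: "('v \<Rightarrow> ennreal) \<Rightarrow> 'v set" where
  "form_kernel q = {u. q u = 0}"

text \<open>The bilinear form; meaningful for arguments in \<^term>\<open>form_domain q\<close>.\<close>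

definition form_bilinear :: "('v::real_vector \<Rightarrow> ennreal) \<Rightarrow> 'v \<Rightarrow> 'v \<Rightarrow> real" where
  "form_bilinear q u v = 1 / 4 * (enn2real (q (u + v)) - enn2real (q (u - v)))"

definition form_seminorm :: "('v \<Rightarrow> ennreal) \<Rightarrow> 'v \<Rightarrow> real" where
  "form_seminorm q u = sqrt (enn2real (q u))"

definition seminorm_topology :: "('v::real_vector \<Rightarrow> ennreal) \<Rightarrow> 'v topology" where
  "seminorm_topology q =
     topology_generated_by
       {{v \<in> form_domain q. form_seminorm q (v - u) < r} | u r. u \<in> form_domain q \<and> 0 < r}"

definition form_topology ::
  "'v::real_vector topology \<Rightarrow> ('v \<Rightarrow> ennreal) \<Rightarrow> 'v topology" where
  "form_topology T q =
     topology_generated_by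
       ({U. openin (subtopology T (form_domain q)) U} \<union> {U. openin (seminorm_topology q) U})"

definition closed_form :: "'v::real_vector topology \<Rightarrow> ('v \<Rightarrow> ennreal) \<Rightarrow> bool" where
  "closed_form T q \<longleftrightarrow> vector_complete (form_topology T q)"


section \<open>The inner product space associated with a quadratic form\<close>

definition form_quotient :: "('v::real_vector \<Rightarrow> ennreal) \<Rightarrow> 'v set set" where
  "form_quotient q = quotient_set (form_domain q) (form_kernel q)"

text \<open>\<open>the_elem\<close> picks the common value of the bilinear form on representatives.\<close>

definition form_inner :: "('v::real_vector \<Rightarrow> ennreal) \<Rightarrow> 'v set \<Rightarrow> 'v set \<Rightarrow> real" where
  "form_inner q A B = the_elem ((\<lambda>(u, v). form_bilinear q u v) ` (A \<times> B))"

definition form_quotient_topology :: "('v::real_vector \<Rightarrow> ennreal) \<Rightarrow> 'v set topology" where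
  "form_quotient_topology q =
     Metric_space.mtopology (form_quotient q)
       (ip_dist (form_quotient q) (+) (coset_scaleR (form_kernel q)) (form_inner q))"

text \<open>Both quotients consist of classes modulo \<^term>\<open>form_kernel q\<close>, so the canonical embedding
  is literally the identity.\<close>

definition form_embedding_continuous ::
  "'v::real_vector topology \<Rightarrow> ('v \<Rightarrow> ennreal) \<Rightarrow> bool" where
  "form_embedding_continuous T q \<longleftrightarrow>
     continuous_map (form_quotient_topology q) (quotient_topology T (form_kernel q)) (\<lambda>A. A)"

definition form_quotient_hilbert :: "('v::real_vector \<Rightarrow> ennreal) \<Rightarrow> bool" where
  "form_quotient_hilbert q \<longleftrightarrow>
     real_hilbert_space_on (form_quotient q) (+) (form_kernel q)
       (coset_scaleR (form_kernel q)) (form_inner q)"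

end

theory Submission
  imports Defs
begin

text \<open>
  Write \<open>D\<close> and \<open>N\<close> for the domain and the kernel of \<open>q\<close>. The embedding is continuous iff for every
  \<open>\<tau>\<close>-neighbourhood \<open>W\<close> of \<open>0\<close> some \<open>q\<close>-ball of \<open>D\<close> is contained in \<open>W + N\<close>.

  (i), (ii) imply (iii): the inclusion of balls in \<open>U\<^sub>k + N\<close>, for a countable family \<open>U\<^sub>k\<close> that with the
  seminorm defines \<open>\<tau>\<^sub>q\<close> at \<open>0\<close>, allows one to lift a fast \<open>q\<close>-Cauchy sequence of \<open>D / N\<close> to a
  \<open>\<tau>\<^sub>q\<close>-Cauchy sequence of \<open>D\<close>.

  (i), (iii) imply (ii): \<open>\<tau>\<close> and \<open>\<tau>\<^sub>q\<close> agree on \<open>N\<close>, which is \<open>\<tau>\<^sub>q\<close>-closed in \<open>D\<close>, hence complete, hence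
  \<open>\<tau>\<close>-closed; continuity is the open mapping theorem for \<open>(D, \<tau>\<^sub>q) \<rightarrow> D / N\<close>, proved by Baire category
  and successive approximation.

  (ii), (iii) imply (i): a \<open>\<tau>\<^sub>q\<close>-Cauchy filter has a \<open>\<tau>\<close>-limit and a \<open>q\<close>-limit, which by (ii) differ by
  an element of \<open>N\<close>.
\<close>

section \<open>The inner product of a quadratic form\<close>

locale quadratic_form_space =
  fixes q :: "'v::real_vector \<Rightarrow> ennreal"
  assumes quadratic: "quadratic_form q"
begin

abbreviation D :: "'v set" where "D \<equiv> form_domain q"
abbreviation N :: "'v set" where "N \<equiv> form_kernel q"
abbreviation snorm :: "'v \<Rightarrow> real" where "snorm \<equiv> form_seminorm q"
abbreviation B :: "'v \<Rightarrow> 'v \<Rightarrow> real" where "B \<equiv> form_bilinear q"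

section \<open>Finite values: the domain as a linear subspace and the real-valued identities\<close>

lemma parallelogram_ennreal: "2 * q u + 2 * q v = q (u + v) + q (u - v)"
  using quadratic by (simp add: quadratic_form_def)

lemma scaleR_ennreal: "q (c *\<^sub>R u) = ennreal (c\<^sup>2) * q u"
  using quadratic by (simp add: quadratic_form_def)

text \<open>Both values are summands of one sum, which the parallelogram identity shows to be
  finite.\<close>

lemma D_add_diff:
  assumes "u \<in> D" "v \<in> D"
  shows "u + v \<in> D" "u - v \<in> D"
proof -
  have "2 * q u + 2 * q v < \<infinity>"
    using assms by (auto simp: form_domain_def ennreal_mult_less_top)
  then have "q (u + v) + q (u - v) < \<infinity>"
    by (simp only: parallelogram_ennreal)
  then show "u + v \<in> D" "u - v \<in> D"
    by (auto simp: form_domain_def)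
qed

lemma D_scaleR: "u \<in> D \<Longrightarrow> c *\<^sub>R u \<in> D"
  by (auto simp: form_domain_def scaleR_ennreal ennreal_mult_less_top)

lemma D_0: "0 \<in> D"
  using scaleR_ennreal[of 0 0] by (simp add: form_domain_def)

lemma D_minus: "u \<in> D \<Longrightarrow> - u \<in> D"
  using D_scaleR[of u "-1"] by simp

lemmas D_intros = D_add_diff D_scaleR D_0 D_minus

lemma form_parallelogram:
  assumes "u \<in> D" "v \<in> D"
  shows "enn2real (q (u + v)) + enn2real (q (u - v)) = 2 * enn2real (q u) + 2 * enn2real (q v)"
proof -
  have fin: "q u < \<infinity>" "q v < \<infinity>" "q (u + v) < \<infinity>" "q (u - v) < \<infinity>"
    using assms D_add_diff[OF assms] by (auto simp: form_domain_def)
  have "enn2real (q (u + v)) + enn2real (q (u - v)) = enn2real (q (u + v) + q (u - v))"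
    using fin by (simp add: enn2real_plus)
  also have "\<dots> = enn2real (2 * q u + 2 * q v)"
    by (simp only: parallelogram_ennreal)
  also have "\<dots> = 2 * enn2real (q u) + 2 * enn2real (q v)"
    using fin by (simp add: enn2real_plus enn2real_mult ennreal_mult_less_top)
  finally show ?thesis .
qed

lemma form_scaleR: "enn2real (q (c *\<^sub>R u)) = c\<^sup>2 * enn2real (q u)"
  by (simp add: scaleR_ennreal enn2real_mult)

lemma form_minus: "enn2real (q (- u)) = enn2real (q u)"
  using form_scaleR[of "-1" u] by simp

lemma form_minus_commute: "enn2real (q (u - v)) = enn2real (q (v - u))"
  using form_minus[of "u - v"] by simp

lemma B_commute: "B u v = B v u"
  by (simp add: form_bilinear_def form_minus_commute[of u v] add.commute)

lemma B_self: "B u u = enn2real (q u)"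
  using form_scaleR[of 2 u] form_scaleR[of 0 0] by (simp add: form_bilinear_def scaleR_2)

lemma B_zero_left: "B 0 w = 0"
  by (simp add: form_bilinear_def form_minus)

text \<open>Subtract the parallelogram identity for \<open>u - w\<close>, \<open>v\<close> from the
  one for \<open>u + w\<close>, \<open>v\<close>; the terms \<open>q v\<close> cancel. This is the
  first half of the Jordan-von Neumann argument.\<close>

lemma B_midpoint:
  assumes "u \<in> D" "v \<in> D" "w \<in> D"
  shows "B (u + v) w + B (u - v) w = 2 * B u w"
  using form_parallelogram[of "u + w" v] form_parallelogram[of "u - w" v] assms
  by (simp add: D_intros form_bilinear_def algebra_simps)

lemma B_add_left:
  assumes "u \<in> D" "v \<in> D" "w \<in> D"
  shows "B (u + v) w = B u w + B v w"
proof -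
  \<comment> \<open>With the half sum \<open>x\<close> and the half difference \<open>y\<close>,
    \<open>B_midpoint\<close> for \<open>x\<close>, \<open>y\<close> and for \<open>x\<close>,
    \<open>x\<close> turns both sides of the claim into \<open>2 * B x w\<close>.\<close>
  define x y where "x = (1/2) *\<^sub>R (u + v)" and "y = (1/2) *\<^sub>R (u - v)"
  have xy: "x + y = u" "x - y = v" "x + x = u + v"
    unfolding x_def y_def
    by (simp_all add: scaleR_add_right[symmetric] scaleR_diff_right[symmetric] flip: scaleR_2)
  have "x \<in> D" "y \<in> D"
    unfolding x_def y_def using assms by (auto intro!: D_intros)
  then show ?thesis
    using B_midpoint[of x y w] B_midpoint[of x x w] assms by (simp add: xy B_zero_left)
qed

lemma form_add:
  assumes "u \<in> D" "v \<in> D"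
  shows "enn2real (q (u + v)) = enn2real (q u) + 2 * B u v + enn2real (q v)"
  using form_parallelogram[OF assms] by (simp add: form_bilinear_def field_simps)

text \<open>For fixed \<open>u, v\<close> the additive function \<open>c \<mapsto> B (c u) v - c B u v\<close> is bounded on \<open>[0,1]\<close> and
  has period 1, hence is bounded; a bounded additive function vanishes.\<close>

lemma B_scaleR_left:
  assumes u: "u \<in> D" and v: "v \<in> D"
  shows "B (c *\<^sub>R u) v = c * B u v"
proof -
  define g where "g c = B (c *\<^sub>R u) v - c * B u v" for c
  define M where "M = enn2real (q u) + enn2real (q v) + \<bar>B u v\<bar>"
  have add: "g (c + d) = g c + g d" for c d
    using B_add_left[of "c *\<^sub>R u" "d *\<^sub>R u" v] u v
    by (simp add: g_def D_scaleR algebra_simps)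
  have g0: "g 0 = 0"
    by (simp add: g_def B_zero_left)
  have nat: "g (real n * c) = real n * g c" for n c
  proof (induction n)
    case (Suc n)
    then show ?case using add[of "real n * c" c] by (simp add: algebra_simps)
  qed (simp add: g0)
  have "g 1 = 0"
    by (simp add: g_def)
  then have gnat: "g (real n) = 0" for n
    using nat[of n 1] by simp
  have gneg: "g (- c) = - g c" for c
    using add[of c "- c"] g0 by simp
  have gint: "g (of_int k) = 0" for k
  proof (cases "k \<ge> 0")
    case True
    then show ?thesis using gnat[of "nat k"] by simp
  next
    case False
    then show ?thesis using gnat[of "nat (- k)"] gneg[of "of_int k"] by simp
  qed
  \<comment> \<open>Nonnegativity of \<open>q\<close> at \<open>t *\<^sub>R u + v\<close> and at
    \<open>t *\<^sub>R u - v\<close> controls \<open>B (t *\<^sub>R u) v\<close> from both sides;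
    the last summand of \<open>M\<close> absorbs \<open>t * B u v\<close>.\<close>
  have bd01: "\<bar>g t\<bar> \<le> M" if "0 \<le> t" "t \<le> 1" for t
  proof -
    have t2: "t\<^sup>2 * enn2real (q u) \<le> enn2real (q u)"
      using that by (intro mult_left_le_one_le) (auto simp: power_le_one)
    have "enn2real (q (t *\<^sub>R u + v)) = t\<^sup>2 * enn2real (q u) + 2 * B (t *\<^sub>R u) v + enn2real (q v)"
      using form_add[of "t *\<^sub>R u" v] u v by (simp add: D_scaleR form_scaleR)
    moreover have "enn2real (q (t *\<^sub>R u + v)) + enn2real (q (t *\<^sub>R u - v))
        = 2 * (t\<^sup>2 * enn2real (q u)) + 2 * enn2real (q v)"
      using form_parallelogram[of "t *\<^sub>R u" v] u v by (simp add: D_scaleR form_scaleR)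
    moreover have "0 \<le> enn2real (q (t *\<^sub>R u + v))" "0 \<le> enn2real (q (t *\<^sub>R u - v))"
      "0 \<le> enn2real (q u)" "0 \<le> enn2real (q v)"
      by simp_all
    ultimately have "\<bar>B (t *\<^sub>R u) v\<bar> \<le> enn2real (q u) + enn2real (q v)"
      using t2 by linarith
    moreover have "\<bar>t * B u v\<bar> \<le> \<bar>B u v\<bar>"
      using that by (simp add: abs_mult mult_left_le_one_le)
    ultimately show ?thesis
      unfolding g_def M_def by linarith
  qed
  have bd: "\<bar>g t\<bar> \<le> M" for t
  proof -
    have "g t = g (frac t)"
      using add[of "of_int \<lfloor>t\<rfloor>" "frac t"] gint[of "\<lfloor>t\<rfloor>"] by (simp add: frac_def)
    then show ?thesis
      using bd01[of "frac t"] frac_ge_0[of t] frac_lt_1[of t] by auto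
  qed
  have "g c = 0"
  proof (rule ccontr)
    assume "g c \<noteq> 0"
    then obtain n where "M < real n * \<bar>g c\<bar>"
      using reals_Archimedean3[of "\<bar>g c\<bar>"] by auto
    with bd[of "real n * c"] show False
      by (simp add: nat abs_mult)
  qed
  then show ?thesis
    by (simp add: g_def)
qed

text \<open>Discriminant argument: the value of \<open>q\<close> at \<open>c *\<^sub>R u + v\<close>
  is a nonnegative polynomial in \<open>c\<close>. It is evaluated at its minimum, or, if the
  leading coefficient vanishes, it is affine and must have slope zero.\<close>

lemma Cauchy_Schwarz:
  assumes "u \<in> D" "v \<in> D"
  shows "(B u v)\<^sup>2 \<le> enn2real (q u) * enn2real (q v)"
proof -
  have *: "0 \<le> c\<^sup>2 * enn2real (q u) + 2 * (c * B u v) + enn2real (q v)" for c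
    using form_add[of "c *\<^sub>R u" v] assms enn2real_nonneg[of "q (c *\<^sub>R u + v)"]
    by (simp add: D_scaleR form_scaleR B_scaleR_left)
  show ?thesis
  proof (cases "enn2real (q u) = 0")
    case True
    have "B u v = 0"
    proof (rule ccontr)
      assume "B u v \<noteq> 0"
      \<comment> \<open>At this \<open>c\<close> the affine function would take the value
        -1.\<close>
      with *[of "- (enn2real (q v) + 1) / (2 * B u v)"] True show False
        by (simp add: field_simps)
    qed
    with True show ?thesis by simp
  next
    case False
    then have pos: "0 < enn2real (q u)"
      by (simp add: less_le)
    have "0 \<le> enn2real (q u) * ((- B u v / enn2real (q u))\<^sup>2 * enn2real (q u)
        + 2 * ((- B u v / enn2real (q u)) * B u v) + enn2real (q v))"
      using *[of "- B u v / enn2real (q u)"] pos by (intro mult_nonneg_nonneg) auto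
    also have "\<dots> = enn2real (q u) * enn2real (q v) - (B u v)\<^sup>2"
      using pos by (simp add: field_simps power2_eq_square)
    finally show ?thesis by simp
  qed
qed

section \<open>The seminorm and the kernel\<close>

lemma snorm_nonneg: "0 \<le> snorm u"
  by (simp add: form_seminorm_def)

lemma snorm_power2: "(snorm u)\<^sup>2 = enn2real (q u)"
  by (simp add: form_seminorm_def)

lemma snorm_scaleR: "snorm (c *\<^sub>R u) = \<bar>c\<bar> * snorm u"
  by (simp add: form_seminorm_def form_scaleR real_sqrt_mult)

lemma snorm_minus: "snorm (- u) = snorm u"
  by (simp add: form_seminorm_def form_minus)

lemma snorm_minus_commute: "snorm (u - v) = snorm (v - u)"
  by (simp add: form_seminorm_def form_minus_commute)

lemma snorm_0: "snorm 0 = 0"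
  using snorm_scaleR[of 0 0] by simp

lemma snorm_triangle:
  assumes "u \<in> D" "v \<in> D"
  shows "snorm (u + v) \<le> snorm u + snorm v"
proof -
  have "\<bar>B u v\<bar> \<le> snorm u * snorm v"
    using Cauchy_Schwarz[OF assms]
    by (simp add: form_seminorm_def flip: real_sqrt_mult) (metis real_sqrt_abs real_sqrt_le_mono)
  then have "(snorm (u + v))\<^sup>2 \<le> (snorm u + snorm v)\<^sup>2"
    using form_add[OF assms] by (simp add: power2_sum snorm_power2)
  then show ?thesis
    by (rule power2_le_imp_le) (simp add: snorm_nonneg)
qed

lemma snorm_triangle_diff:
  assumes "u \<in> D" "v \<in> D"
  shows "snorm (u - v) \<le> snorm u + snorm v"
  using snorm_triangle[of u "- v"] assms by (simp add: D_minus snorm_minus)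

lemma snorm_triangle_via:
  assumes "u \<in> D" "v \<in> D" "w \<in> D"
  shows "snorm (u - w) \<le> snorm (u - v) + snorm (v - w)"
  using snorm_triangle[of "u - v" "v - w"] assms by (simp add: D_intros)

lemma N_iff: "u \<in> N \<longleftrightarrow> u \<in> D \<and> snorm u = 0"
  by (auto simp: form_kernel_def form_domain_def form_seminorm_def enn2real_eq_0_iff)

lemma N_subset_D: "u \<in> N \<Longrightarrow> u \<in> D"
  by (simp add: N_iff)

lemma N_intros:
  shows "0 \<in> N"
    and "u \<in> N \<Longrightarrow> v \<in> N \<Longrightarrow> u + v \<in> N"
    and "u \<in> N \<Longrightarrow> v \<in> N \<Longrightarrow> u - v \<in> N"
    and "u \<in> N \<Longrightarrow> c *\<^sub>R u \<in> N"
    and "u \<in> N \<Longrightarrow> - u \<in> N"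
  using snorm_triangle[of u v] snorm_triangle_diff[of u v] snorm_nonneg[of "u + v"]
    snorm_nonneg[of "u - v"]
  by (auto simp: N_iff D_intros snorm_0 snorm_scaleR snorm_minus)

lemma snorm_add_N:
  assumes "u \<in> D" "n \<in> N"
  shows "snorm (u + n) = snorm u"
  using snorm_triangle[of u n] snorm_triangle_diff[of "u + n" n] assms
  by (simp add: N_iff D_intros)

text \<open>Cauchy-Schwarz puts the kernel into the radical of \<open>B\<close>, so that
  \<open>B\<close> descends to the quotient.\<close>

lemma B_N:
  assumes "u \<in> D" "n \<in> N"
  shows "B u n = 0" "B n u = 0"
  using Cauchy_Schwarz[of u n] assms B_commute[of u n] snorm_power2[of n] by (auto simp: N_iff)

lemma B_add_right:
  assumes "u \<in> D" "v \<in> D" "w \<in> D"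
  shows "B w (u + v) = B w u + B w v"
  using B_add_left[OF assms] by (simp add: B_commute)

subsection \<open>The quotient by the kernel\<close>

lemma coset_eq_iff: "u +o N = v +o N \<longleftrightarrow> u - v \<in> N"
proof
  assume "u +o N = v +o N"
  then have "u + 0 \<in> v +o N"
    using N_intros(1) by blast
  then show "u - v \<in> N"
    by (simp add: set_minus_plus)
next
  have sub: "u +o N \<subseteq> v +o N" if "u - v \<in> N" for u v
  proof
    fix x assume "x \<in> u +o N"
    then have "x - u \<in> N"
      by (simp add: set_minus_plus)
    then have "(x - u) + (u - v) \<in> N"
      using that by (rule N_intros(2))
    then show "x \<in> v +o N"
      by (simp flip: set_minus_plus)
  qed
  assume "u - v \<in> N"
  moreover from this have "v - u \<in> N"
    using N_intros(5)[of "u - v"] by simp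
  ultimately show "u +o N = v +o N"
    using sub by blast
qed

lemma N_plus_N: "N + N = N"
proof
  show "N + N \<subseteq> N"
    by (auto simp: set_plus_def N_intros)
  show "N \<subseteq> N + N"
    using set_plus_intro[OF _ N_intros(1), of _ N] by auto
qed

lemma coset_add: "(u +o N) + (v +o N) = (u + v) +o N"
  by (simp add: set_plus_rearrange N_plus_N)

lemma coset_scaleR_coset: "coset_scaleR N c (u +o N) = (c *\<^sub>R u) +o N"
proof -
  have img: "(\<lambda>a. c *\<^sub>R a) ` (u +o N) = (c *\<^sub>R u) +o ((\<lambda>a. c *\<^sub>R a) ` N)"
    by (auto simp: elt_set_plus_def image_def scaleR_add_right)
  have "(\<lambda>a. c *\<^sub>R a) ` N + N = N"
  proof
    show "(\<lambda>a. c *\<^sub>R a) ` N + N \<subseteq> N"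
      by (auto simp: set_plus_def N_intros)
    have "0 \<in> (\<lambda>a. c *\<^sub>R a) ` N"
      using N_intros(1) by force
    then show "N \<subseteq> (\<lambda>a. c *\<^sub>R a) ` N + N"
      by (rule set_zero_plus2)
  qed
  then show ?thesis
    by (simp add: coset_scaleR_def img set_plus_rearrange3)
qed

text \<open>Justifies \<open>the_elem\<close> in \<open>form_inner\<close>: shifting representatives
  by kernel elements does not change \<open>B\<close>, so the image is a singleton.\<close>

lemma form_inner_coset:
  assumes "u \<in> D" "v \<in> D"
  shows "form_inner q (u +o N) (v +o N) = B u v"
proof -
  have eq: "B (u + m) (v + n) = B u v" if "m \<in> N" "n \<in> N" for m n
    using assms that N_subset_D[OF that(1)] N_subset_D[OF that(2)]
    by (simp add: B_add_left B_add_right B_N D_intros)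
  have "(\<lambda>(u, v). B u v) ` ((u +o N) \<times> (v +o N)) = {B u v}"
  proof
    show "(\<lambda>(u, v). B u v) ` ((u +o N) \<times> (v +o N)) \<subseteq> {B u v}"
      using eq by (auto simp: elt_set_plus_def)
    have "(u + 0, v + 0) \<in> (u +o N) \<times> (v +o N)"
      using N_intros(1) by blast
    then show "{B u v} \<subseteq> (\<lambda>(u, v). B u v) ` ((u +o N) \<times> (v +o N))"
      by force
  qed
  then show ?thesis
    by (simp add: form_inner_def)
qed

section \<open>The quotient as an inner product space and as a metric space\<close>

abbreviation coset_dist :: "'v set \<Rightarrow> 'v set \<Rightarrow> real" where
  "coset_dist \<equiv> ip_dist (form_quotient q) (+) (coset_scaleR N) (form_inner q)"

lemma coset_in_form_quotient: "u \<in> D \<Longrightarrow> u +o N \<in> form_quotient q"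
  by (simp add: form_quotient_def quotient_set_def)

lemma form_quotient_cases:
  assumes "A \<in> form_quotient q"
  obtains u where "u \<in> D" "A = u +o N"
  using assms by (auto simp: form_quotient_def quotient_set_def)

lemma coset_dist_coset:
  assumes "u \<in> D" "v \<in> D"
  shows "coset_dist (u +o N) (v +o N) = snorm (u - v)"
  using assms
  by (simp add: ip_dist_def coset_in_form_quotient coset_add coset_scaleR_coset
      form_inner_coset B_self D_intros form_seminorm_def)

lemma form_quotient_inner_space:
  "real_inner_space_on (form_quotient q) (+) N (coset_scaleR N) (form_inner q)"
proof
  have N0: "N = 0 +o N"
    by simp
  show "N \<in> form_quotient q"
    using coset_in_form_quotient[OF D_0] by simp
  fix x y z :: "'v set" and c d :: real
  assume "x \<in> form_quotient q"
  then obtain u where u: "u \<in> D" "x = u +o N" by (rule form_quotient_cases)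
  show "coset_scaleR N c x \<in> form_quotient q"
    using u by (simp add: coset_scaleR_coset coset_in_form_quotient D_intros)
  show "x + N = x"
    using coset_add[of u 0] u by simp
  show "x + coset_scaleR N (- 1) x = N"
    using u by (simp add: coset_scaleR_coset coset_add)
  show "coset_scaleR N (c + d) x = coset_scaleR N c x + coset_scaleR N d x"
    "coset_scaleR N c (coset_scaleR N d x) = coset_scaleR N (c * d) x"
    "coset_scaleR N 1 x = x"
    using u by (simp_all add: coset_scaleR_coset coset_add scaleR_add_left)
  show "0 \<le> form_inner q x x"
    using u by (simp add: form_inner_coset B_self)
  show "x = N" if "form_inner q x x = 0"
  proof -
    have "u \<in> N"
      using u that by (simp add: form_inner_coset B_self N_iff form_seminorm_def)
    then show ?thesis
      using u coset_eq_iff[of u 0] by simp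
  qed
  assume "y \<in> form_quotient q"
  then obtain v where v: "v \<in> D" "y = v +o N" by (rule form_quotient_cases)
  show "x + y \<in> form_quotient q" "x + y = y + x"
    using u v by (simp_all add: coset_add coset_in_form_quotient D_intros add.commute)
  show "coset_scaleR N c (x + y) = coset_scaleR N c x + coset_scaleR N c y"
    using u v by (simp add: coset_scaleR_coset coset_add scaleR_add_right)
  show "form_inner q x y = form_inner q y x"
    using u v by (simp add: form_inner_coset B_commute)
  show "form_inner q (coset_scaleR N c x) y = c * form_inner q x y"
    using u v by (simp add: form_inner_coset coset_scaleR_coset B_scaleR_left D_intros)
  assume "z \<in> form_quotient q"
  then obtain w where w: "w \<in> D" "z = w +o N" by (rule form_quotient_cases)
  show "x + y + z = x + (y + z)"
    using u v w by (simp add: coset_add add.assoc)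
  show "form_inner q (x + y) z = form_inner q x z + form_inner q y z"
    using u v w by (simp add: form_inner_coset coset_add B_add_left D_intros)
qed

sublocale quot: Metric_space "form_quotient q" coset_dist
proof
  have outside: "coset_dist x y = 0" if "x \<notin> form_quotient q \<or> y \<notin> form_quotient q" for x y
    using that by (auto simp: ip_dist_def)
  fix x y z
  show "0 \<le> coset_dist x y"
  proof (cases "x \<in> form_quotient q \<and> y \<in> form_quotient q")
    case True
    then show ?thesis
      by (metis form_quotient_cases coset_dist_coset snorm_nonneg)
  qed (use outside in auto)
  show "coset_dist x y = coset_dist y x"
  proof (cases "x \<in> form_quotient q \<and> y \<in> form_quotient q")
    case True
    then show ?thesis
      by (metis form_quotient_cases coset_dist_coset snorm_minus_commute)
  qed (use outside in auto)
  assume "x \<in> form_quotient q" "y \<in> form_quotient q"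
  then obtain u v where uv: "u \<in> D" "x = u +o N" "v \<in> D" "y = v +o N"
    by (elim form_quotient_cases)
  then show "(coset_dist x y = 0) = (x = y)"
    by (simp add: coset_dist_coset coset_eq_iff N_iff D_intros)
  assume "z \<in> form_quotient q"
  then obtain w where "w \<in> D" "z = w +o N"
    by (elim form_quotient_cases)
  with uv show "coset_dist x z \<le> coset_dist x y + coset_dist y z"
    by (simp add: coset_dist_coset snorm_triangle_via)
qed

lemma form_quotient_topology_eq: "form_quotient_topology q = quot.mtopology"
  by (simp add: form_quotient_topology_def)

text \<open>The inner product axioms hold for every quadratic form, so only completeness is left of
  assertion (iii).\<close>

lemma form_quotient_hilbert_iff: "form_quotient_hilbert q \<longleftrightarrow> quot.mcomplete"
  using form_quotient_inner_space
  by (auto simp: form_quotient_hilbert_def real_hilbert_space_on_def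
      real_hilbert_space_on_axioms_def)

lemma coset_mball_iff:
  assumes "u \<in> D" "v \<in> D"
  shows "v +o N \<in> quot.mball (u +o N) r \<longleftrightarrow> snorm (v - u) < r"
  using assms by (simp add: coset_in_form_quotient coset_dist_coset snorm_minus_commute)

lemma MCauchy_coset_iff:
  assumes "\<And>n. u n \<in> D"
  shows "quot.MCauchy (\<lambda>n. u n +o N) \<longleftrightarrow>
    (\<forall>e>0. \<exists>M. \<forall>m\<ge>M. \<forall>n\<ge>M. snorm (u m - u n) < e)"
  using assms by (auto simp: quot.MCauchy_def coset_dist_coset coset_in_form_quotient)

lemma limitin_coset_iff:
  assumes "\<And>n. u n \<in> D" "l \<in> D"
  shows "limitin quot.mtopology (\<lambda>n. u n +o N) (l +o N) F \<longleftrightarrow>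
    (\<forall>e>0. \<forall>\<^sub>F n in F. snorm (u n - l) < e)"
  using assms by (simp add: quot.limitin_metric coset_dist_coset coset_in_form_quotient)

end

section \<open>Neighbourhoods of zero in a topological vector space\<close>

locale tvs =
  fixes T :: "'v::real_vector topology"
  assumes tvs: "topological_vector_space T"
begin

lemma topspace_UNIV [simp]: "topspace T = UNIV"
  and Hausdorff: "Hausdorff_space T"
  and continuous_map_add: "continuous_map (prod_topology T T) T (\<lambda>(x, y). x + y)"
  and continuous_map_scaleR: "continuous_map (prod_topology euclideanreal T) T (\<lambda>(c, x). c *\<^sub>R x)"
  using tvs by (auto simp: topological_vector_space_def)

lemma continuous_map_translation: "continuous_map T T (\<lambda>x. x + a)"
proof -
  have "continuous_map T (prod_topology T T) (\<lambda>x. (x, a))"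
    by (simp add: continuous_map_pairedI)
  from continuous_map_compose[OF this continuous_map_add] show ?thesis
    by (simp add: o_def)
qed

lemma continuous_map_homothety: "continuous_map T T (\<lambda>x. c *\<^sub>R x)"
proof -
  have "continuous_map T (prod_topology euclideanreal T) (\<lambda>x. (c, x))"
    by (simp add: continuous_map_pairedI)
  from continuous_map_compose[OF this continuous_map_scaleR] show ?thesis
    by (simp add: o_def)
qed

lemma continuous_map_ray: "continuous_map euclideanreal T (\<lambda>c. c *\<^sub>R x)"
proof -
  have "continuous_map euclideanreal (prod_topology euclideanreal T) (\<lambda>c. (c, x))"
    by (intro continuous_map_pairedI) auto
  from continuous_map_compose[OF this continuous_map_scaleR] show ?thesis
    by (simp add: o_def)
qed

lemma openin_translation: "openin T U \<Longrightarrow> openin T {x. x + a \<in> U}"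
  using openin_continuous_map_preimage[OF continuous_map_translation] by simp

definition nbhd :: "'v set \<Rightarrow> bool" where
  "nbhd U \<longleftrightarrow> openin T U \<and> 0 \<in> U"

lemma nbhd_Int: "nbhd U \<Longrightarrow> nbhd W \<Longrightarrow> nbhd (U \<inter> W)"
  by (auto simp: nbhd_def)

lemma nbhd_UNIV: "nbhd UNIV"
  using openin_topspace[of T] by (simp add: nbhd_def)

lemma nbhd_translation: "openin T U \<Longrightarrow> a \<in> U \<Longrightarrow> nbhd {x. x + a \<in> U}"
  by (simp add: nbhd_def openin_translation)

lemma openin_translate_nbhd: "nbhd W \<Longrightarrow> openin T {x. x - a \<in> W}"
  using openin_translation[of W "- a"] by (simp add: nbhd_def)

text \<open>Continuity of addition at \<open>(0, 0)\<close>. Intersecting with the reflected set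
  makes \<open>W\<close> symmetric, so that differences of points of \<open>W\<close> lie in
  \<open>U\<close> too; this takes the place of splitting an epsilon in half.\<close>

lemma nbhd_half:
  assumes "nbhd U"
  obtains W where "nbhd W" "\<And>x. x \<in> W \<Longrightarrow> - x \<in> W" "\<And>x y. x \<in> W \<Longrightarrow> y \<in> W \<Longrightarrow> x + y \<in> U"
proof -
  have "openin (prod_topology T T) {p \<in> topspace (prod_topology T T). (case p of (x, y) \<Rightarrow> x + y) \<in> U}"
    using openin_continuous_map_preimage[OF continuous_map_add] assms by (auto simp: nbhd_def)
  then have "openin (prod_topology T T) {(x, y). x + y \<in> U}"
    by (simp add: case_prod_unfold)
  moreover have "(0, 0) \<in> {(x, y). x + y \<in> U}"
    using assms by (simp add: nbhd_def)
  ultimately obtain X Y where XY: "openin T X" "openin T Y" "0 \<in> X" "0 \<in> Y"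
    "X \<times> Y \<subseteq> {(x, y). x + y \<in> U}"
    using openin_prod_topology_alt[THEN iffD1, rule_format, of T T _ 0 0] that by metis
  define W where "W = (X \<inter> Y) \<inter> {x. - x \<in> X \<inter> Y}"
  have "openin T {x. - x \<in> X \<inter> Y}"
    using openin_continuous_map_preimage[OF continuous_map_homothety[of "-1"], of "X \<inter> Y"] XY
    by (simp add: openin_Int)
  with XY have "nbhd W"
    by (auto simp: nbhd_def W_def openin_Int)
  then show thesis
    by (rule that) (use XY(5) in \<open>auto simp: W_def\<close>)
qed

text \<open>Continuity of scalar multiplication along the line through \<open>x\<close>. The integer
  multiples of \<open>U\<close> thus cover the space, as the Baire argument requires.\<close>

lemma nbhd_absorbing:
  assumes "nbhd U"
  obtains n :: nat where "n > 0" "(1 / real n) *\<^sub>R x \<in> U"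
proof -
  have "open {c. c *\<^sub>R x \<in> U}"
    using openin_continuous_map_preimage[OF continuous_map_ray, of U x] assms
    by (simp add: nbhd_def)
  moreover have "0 \<in> {c. c *\<^sub>R x \<in> U}"
    using assms by (simp add: nbhd_def)
  ultimately obtain e where e: "e > 0" "ball 0 e \<subseteq> {c. c *\<^sub>R x \<in> U}"
    using open_contains_ball by blast
  obtain n where n: "n > 0" "1 / real n < e"
    using ex_inverse_of_nat_less[OF e(1)] by (auto simp: divide_inverse)
  then have "1 / real n \<in> ball 0 e"
    by simp
  with e(2) n(1) show thesis
    using that by blast
qed

lemma limitin_iff_nbhd:
  "limitin T f l F \<longleftrightarrow> (\<forall>W. nbhd W \<longrightarrow> (\<forall>\<^sub>F x in F. f x - l \<in> W))"
proof
  assume lim: "limitin T f l F"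
  show "\<forall>W. nbhd W \<longrightarrow> (\<forall>\<^sub>F x in F. f x - l \<in> W)"
  proof (intro allI impI)
    fix W assume "nbhd W"
    then have "openin T {x. x - l \<in> W}" "l \<in> {x. x - l \<in> W}"
      by (auto simp: openin_translate_nbhd) (simp add: nbhd_def)
    with lim show "\<forall>\<^sub>F x in F. f x - l \<in> W"
      unfolding limitin_def by fastforce
  qed
next
  assume *: "\<forall>W. nbhd W \<longrightarrow> (\<forall>\<^sub>F x in F. f x - l \<in> W)"
  show "limitin T f l F"
    unfolding limitin_def
  proof (intro conjI allI impI)
    fix U assume "openin T U \<and> l \<in> U"
    then have "nbhd {x. x + l \<in> U}"
      using nbhd_translation by blast
    with * show "\<forall>\<^sub>F x in F. f x \<in> U"
      by fastforce
  qed simp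
qed

lemma closedin_if_approx:
  assumes "\<And>v. (\<And>W. nbhd W \<Longrightarrow> \<exists>n\<in>S. n - v \<in> W) \<Longrightarrow> v \<in> S"
  shows "closedin T S"
proof -
  have "v \<in> S" if v: "v \<in> T closure_of S" for v
  proof (rule assms)
    fix W assume "nbhd W"
    then have "openin T {x. x - v \<in> W}" "v \<in> {x. x - v \<in> W}"
      by (auto simp: openin_translate_nbhd) (simp add: nbhd_def)
    then have "\<exists>n. n \<in> S \<and> n \<in> {x. x - v \<in> W}"
      using v unfolding in_closure_of by metis
    then show "\<exists>n\<in>S. n - v \<in> W"
      by blast
  qed
  then show ?thesis
    by (metis closure_of_subset closure_of_eq subsetI subset_antisym subset_UNIV topspace_UNIV)
qed

lemma approx_if_closedin:
  assumes "closedin T S" and approx: "\<And>W. nbhd W \<Longrightarrow> \<exists>n\<in>S. n - v \<in> W"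
  shows "v \<in> S"
proof -
  have "v \<in> T closure_of S"
    unfolding in_closure_of
  proof (intro conjI allI impI)
    fix U assume "v \<in> U \<and> openin T U"
    then have "nbhd {x. x + v \<in> U}"
      using nbhd_translation by blast
    then show "\<exists>y. y \<in> S \<and> y \<in> U"
      using approx by fastforce
  qed simp
  with assms(1) show ?thesis
    by (simp add: closure_of_closedin)
qed

end

section \<open>The form topology\<close>

locale tvs_quadratic_form = tvs T + quadratic_form_space q
  for T :: "'v::real_vector topology" and q :: "'v \<Rightarrow> ennreal"
begin

text \<open>A pointwise description of the open sets of \<open>form_topology\<close>; once
  \<open>openin_form_topology\<close> is proved, it replaces the generated topology
  everywhere.\<close>

definition form_open :: "'v set \<Rightarrow> bool" where
  "form_open U \<longleftrightarrow> U \<subseteq> D \<and>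
    (\<forall>x\<in>U. \<exists>W e. nbhd W \<and> 0 < e \<and> {v \<in> D. v - x \<in> W \<and> snorm (v - x) < e} \<subseteq> U)"

lemma form_openE:
  assumes "form_open U" "x \<in> U"
  obtains W e where "nbhd W" "0 < e" "{v \<in> D. v - x \<in> W \<and> snorm (v - x) < e} \<subseteq> U"
proof -
  have "\<exists>W e. nbhd W \<and> 0 < e \<and> {v \<in> D. v - x \<in> W \<and> snorm (v - x) < e} \<subseteq> U"
    using assms unfolding form_open_def by blast
  then show thesis
    by (elim exE conjE) (rule that)
qed

text \<open>Reduces the identification of the generated topology to its generators:
  \<open>form_open\<close> is stable under binary intersections and arbitrary unions.\<close>

lemma form_open_generated:
  assumes "generate_topology_on S U" "\<And>s. s \<in> S \<Longrightarrow> form_open s"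
  shows "form_open U"
  using assms(1)
proof (induction rule: generate_topology_on.induct)
  case Empty
  then show ?case by (simp add: form_open_def)
next
  case (Int a b)
  show ?case
    unfolding form_open_def
  proof (intro conjI ballI)
    show "a \<inter> b \<subseteq> D"
      using Int.IH by (auto simp: form_open_def)
    fix x assume x: "x \<in> a \<inter> b"
    obtain V d where V: "nbhd V" "0 < d" "{v \<in> D. v - x \<in> V \<and> snorm (v - x) < d} \<subseteq> a"
      using Int.IH(1) IntD1[OF x] by (rule form_openE)
    obtain W e where W: "nbhd W" "0 < e" "{v \<in> D. v - x \<in> W \<and> snorm (v - x) < e} \<subseteq> b"
      using Int.IH(2) IntD2[OF x] by (rule form_openE)
    from V W have "nbhd (V \<inter> W) \<and> 0 < min d e \<and>
        {v \<in> D. v - x \<in> V \<inter> W \<and> snorm (v - x) < min d e} \<subseteq> a \<inter> b"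
      by (auto simp: nbhd_Int)
    then show "\<exists>W e. nbhd W \<and> 0 < e \<and> {v \<in> D. v - x \<in> W \<and> snorm (v - x) < e} \<subseteq> a \<inter> b"
      by blast
  qed
next
  case (UN K)
  show ?case
    unfolding form_open_def
  proof (intro conjI ballI)
    show "\<Union>K \<subseteq> D"
      using UN.IH by (auto simp: form_open_def)
    fix x assume "x \<in> \<Union>K"
    then obtain k where k: "k \<in> K" "x \<in> k" by blast
    then obtain W e where "nbhd W" "0 < e" "{v \<in> D. v - x \<in> W \<and> snorm (v - x) < e} \<subseteq> k"
      using UN.IH[OF k(1)] k(2) by (elim form_openE)
    with k(1) show "\<exists>W e. nbhd W \<and> 0 < e \<and> {v \<in> D. v - x \<in> W \<and> snorm (v - x) < e} \<subseteq> \<Union>K"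
      by blast
  qed
qed (use assms(2) in blast)

lemma form_open_seminorm_topology:
  assumes "openin (seminorm_topology q) U"
  shows "form_open U"
proof (rule form_open_generated)
  show "generate_topology_on
      {{v \<in> D. snorm (v - u) < r} | u r. u \<in> D \<and> 0 < r} U"
    using assms by (simp add: seminorm_topology_def openin_topology_generated_by_iff)
next
  fix s assume "s \<in> {{v \<in> D. snorm (v - u) < r} | u r. u \<in> D \<and> 0 < r}"
  then obtain u r where s: "s = {v \<in> D. snorm (v - u) < r}" "u \<in> D" "0 < r"
    by blast
  \<comment> \<open>By the triangle inequality the radius left around \<open>x\<close> is
    \<open>r - snorm (x - u)\<close>; \<open>UNIV\<close> makes the condition on \<open>T\<close>
    vacuous.\<close>
  have "{v \<in> D. v - x \<in> UNIV \<and> snorm (v - x) < r - snorm (x - u)} \<subseteq> s" if "x \<in> s" for x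
    using that s snorm_triangle_via[of _ x u] by fastforce
  moreover have "0 < r - snorm (x - u)" if "x \<in> s" for x
    using that s by auto
  ultimately show "form_open s"
    unfolding form_open_def using nbhd_UNIV s(1) by blast
qed

lemma form_open_subtopology:
  assumes "openin (subtopology T D) U"
  shows "form_open U"
proof -
  obtain G where G: "openin T G" "U = G \<inter> D"
    using assms by (auto simp: openin_subtopology)
  have "nbhd {v. v + x \<in> G}" "{v \<in> D. v - x \<in> {v. v + x \<in> G} \<and> snorm (v - x) < 1} \<subseteq> U"
    if "x \<in> U" for x
    using that G by (auto intro: nbhd_translation)
  moreover have "U \<subseteq> D"
    using G by blast
  ultimately show ?thesis
    unfolding form_open_def using zero_less_one by blast
qed

lemma openin_form_basic:
  assumes "nbhd W" "0 < e" "x \<in> D"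
  shows "openin (form_topology T q) {v \<in> D. v - x \<in> W \<and> snorm (v - x) < e}"
proof -
  have "openin (subtopology T D) ({v. v - x \<in> W} \<inter> D)"
    using openin_translate_nbhd[OF assms(1)] by (auto simp: openin_subtopology)
  moreover have "openin (seminorm_topology q) {v \<in> D. snorm (v - x) < e}"
    unfolding seminorm_topology_def by (rule topology_generated_by_Basis) (use assms in blast)
  ultimately have "openin (form_topology T q) (({v. v - x \<in> W} \<inter> D) \<inter> {v \<in> D. snorm (v - x) < e})"
    unfolding form_topology_def by (intro openin_Int topology_generated_by_Basis) auto
  moreover have "({v. v - x \<in> W} \<inter> D) \<inter> {v \<in> D. snorm (v - x) < e} =
      {v \<in> D. v - x \<in> W \<and> snorm (v - x) < e}"
    by blast
  ultimately show ?thesis by simp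
qed

lemma openin_form_topology: "openin (form_topology T q) U \<longleftrightarrow> form_open U"
proof
  assume "openin (form_topology T q) U"
  then have "generate_topology_on
      ({U. openin (subtopology T D) U} \<union> {U. openin (seminorm_topology q) U}) U"
    by (simp add: form_topology_def openin_topology_generated_by_iff)
  then show "form_open U"
    by (rule form_open_generated) (auto intro: form_open_subtopology form_open_seminorm_topology)
next
  assume U: "form_open U"
  show "openin (form_topology T q) U"
  proof (subst openin_subopen, intro ballI)
    fix x assume x: "x \<in> U"
    then obtain W e where W: "nbhd W" "0 < e" "{v \<in> D. v - x \<in> W \<and> snorm (v - x) < e} \<subseteq> U"
      using U by (elim form_openE)
    moreover have "x \<in> D"
      using U x by (auto simp: form_open_def)
    ultimately show "\<exists>S. openin (form_topology T q) S \<and> x \<in> S \<and> S \<subseteq> U"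
      using openin_form_basic[of W e x]
      by (intro exI[of _ "{v \<in> D. v - x \<in> W \<and> snorm (v - x) < e}"]) (auto simp: nbhd_def snorm_0)
  qed
qed

lemma topspace_form_topology: "topspace (form_topology T q) = D"
proof
  show "topspace (form_topology T q) \<subseteq> D"
    using openin_form_topology[of "topspace (form_topology T q)"] by (simp add: form_open_def)
  have "form_open D"
    using nbhd_UNIV zero_less_one unfolding form_open_def by blast
  then show "D \<subseteq> topspace (form_topology T q)"
    by (simp add: openin_subset flip: openin_form_topology)
qed

section \<open>Convergence and Cauchy filters in the form topology\<close>

lemma limitin_form_topology_iff:
  "limitin (form_topology T q) f l F \<longleftrightarrow> l \<in> D \<and>
    (\<forall>W e. nbhd W \<longrightarrow> 0 < e \<longrightarrow> (\<forall>\<^sub>F x in F. f x \<in> D \<and> f x - l \<in> W \<and> snorm (f x - l) < e))"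
proof (intro iffI conjI allI impI)
  assume lim: "limitin (form_topology T q) f l F"
  then show l: "l \<in> D"
    by (simp add: limitin_def topspace_form_topology)
  fix W and e :: real assume We: "nbhd W" "0 < e"
  have "l \<in> {v \<in> D. v - l \<in> W \<and> snorm (v - l) < e}"
    using We l by (simp add: nbhd_def snorm_0)
  then have "\<forall>\<^sub>F x in F. f x \<in> {v \<in> D. v - l \<in> W \<and> snorm (v - l) < e}"
    using lim openin_form_basic[OF We l] unfolding limitin_def by blast
  then show "\<forall>\<^sub>F x in F. f x \<in> D \<and> f x - l \<in> W \<and> snorm (f x - l) < e"
    by simp
next
  assume *: "l \<in> D \<and>
    (\<forall>W e. nbhd W \<longrightarrow> 0 < e \<longrightarrow> (\<forall>\<^sub>F x in F. f x \<in> D \<and> f x - l \<in> W \<and> snorm (f x - l) < e))"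
  show "limitin (form_topology T q) f l F"
    unfolding limitin_def topspace_form_topology openin_form_topology
  proof (intro conjI allI impI)
    fix U assume "form_open U \<and> l \<in> U"
    then obtain W e where "nbhd W" "0 < e" "{v \<in> D. v - l \<in> W \<and> snorm (v - l) < e} \<subseteq> U"
      by (elim conjE form_openE)
    moreover from this * have "\<forall>\<^sub>F x in F. f x \<in> D \<and> f x - l \<in> W \<and> snorm (f x - l) < e"
      by blast
    ultimately show "\<forall>\<^sub>F x in F. f x \<in> U"
      by (auto elim: eventually_mono)
  qed (use * in blast)
qed

lemma vector_cauchy_filter_form_topology_iff:
  "vector_cauchy_filter (form_topology T q) F \<longleftrightarrow>
    (\<forall>W e. nbhd W \<longrightarrow> 0 < e \<longrightarrow>
      (\<forall>\<^sub>F (x, y) in F \<times>\<^sub>F F. x - y \<in> D \<and> x - y \<in> W \<and> snorm (x - y) < e))"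
proof (intro iffI allI impI)
  fix W and e :: real
  assume F: "vector_cauchy_filter (form_topology T q) F" and We: "nbhd W" "0 < e"
  have "0 \<in> {v \<in> D. v - 0 \<in> W \<and> snorm (v - 0) < e}"
    using We D_0 by (simp add: nbhd_def snorm_0)
  then have "\<forall>\<^sub>F (x, y) in F \<times>\<^sub>F F. x - y \<in> {v \<in> D. v - 0 \<in> W \<and> snorm (v - 0) < e}"
    using F openin_form_basic[OF We D_0] unfolding vector_cauchy_filter_def by blast
  then show "\<forall>\<^sub>F (x, y) in F \<times>\<^sub>F F. x - y \<in> D \<and> x - y \<in> W \<and> snorm (x - y) < e"
    by simp
next
  assume *: "\<forall>W e. nbhd W \<longrightarrow> 0 < e \<longrightarrow>
      (\<forall>\<^sub>F (x, y) in F \<times>\<^sub>F F. x - y \<in> D \<and> x - y \<in> W \<and> snorm (x - y) < e)"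
  show "vector_cauchy_filter (form_topology T q) F"
    unfolding vector_cauchy_filter_def openin_form_topology
  proof (intro allI impI)
    fix U assume "form_open U \<and> 0 \<in> U"
    then obtain W e where We: "nbhd W" "0 < e" "{v \<in> D. v - 0 \<in> W \<and> snorm (v - 0) < e} \<subseteq> U"
      by (elim conjE form_openE)
    with * have "\<forall>\<^sub>F (x, y) in F \<times>\<^sub>F F. x - y \<in> D \<and> x - y \<in> W \<and> snorm (x - y) < e"
      by blast
    then show "\<forall>\<^sub>F (x, y) in F \<times>\<^sub>F F. x - y \<in> U"
      by (rule eventually_mono) (use We(3) in auto)
  qed
qed

text \<open>The last condition says that the sets \<open>U k\<close>, intersected with seminorm balls, form a base at \<open>0\<close>
  of the form topology.\<close>

definition string_base :: "(nat \<Rightarrow> 'v set) \<Rightarrow> bool" where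
  "string_base U \<longleftrightarrow>
    (\<forall>n. nbhd (U n)) \<and> (\<forall>n. \<forall>x\<in>U n. - x \<in> U n) \<and>
    (\<forall>n. \<forall>x\<in>U (Suc n). \<forall>y\<in>U (Suc n). x + y \<in> U n) \<and>
    (\<forall>V. nbhd V \<longrightarrow> (\<exists>k e. 0 < e \<and> (\<forall>x\<in>D \<inter> U k. snorm x < e \<longrightarrow> x \<in> V)))"

lemma string_baseD:
  assumes "string_base U"
  shows "nbhd (U n)" "0 \<in> U n" "x \<in> U n \<Longrightarrow> - x \<in> U n"
    "x \<in> U (Suc n) \<Longrightarrow> y \<in> U (Suc n) \<Longrightarrow> x + y \<in> U n"
  using assms by (auto simp: string_base_def nbhd_def)

lemma string_base_antimono:
  assumes "string_base U" "m \<le> n"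
  shows "U n \<subseteq> U m"
  using lift_Suc_antimono_le[of U m n] string_baseD(2,4)[OF assms(1)] assms(2)
  by (metis add.right_neutral subsetI)

text \<open>Metrizability enters as first countability of the form topology at \<open>0\<close>. The
  topology \<open>T\<close> itself may fail to be first countable, so its neighbourhoods are reached
  only jointly by \<open>U k\<close> and a seminorm ball.\<close>

lemma string_base_exists:
  assumes "metrizable_space (form_topology T q)" "nbhd V"
  obtains U where "string_base U" "U 0 \<subseteq> V"
proof -
  have "first_countable (form_topology T q)"
    using assms(1) by (rule metrizable_imp_first_countable)
  then obtain \<B> where \<B>: "countable \<B>" "\<And>G. G \<in> \<B> \<Longrightarrow> form_open G"
    "\<And>S. form_open S \<and> 0 \<in> S \<Longrightarrow> \<exists>G\<in>\<B>. 0 \<in> G \<and> G \<subseteq> S"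
    unfolding first_countable_def topspace_form_topology openin_form_topology using D_0 by metis
  define \<G> where "\<G> = {G \<in> \<B>. 0 \<in> G}"
  have "form_open D"
    using openin_topspace[of "form_topology T q"]
    by (simp add: topspace_form_topology openin_form_topology)
  then have ne: "\<G> \<noteq> {}"
    using \<B>(3)[of D] D_0 by (auto simp: \<G>_def)
  have cnt: "countable \<G>"
    using \<B>(1) by (auto simp: \<G>_def)
  define G where "G = from_nat_into \<G>"
  have G: "form_open (G n)" "0 \<in> G n" for n
    using from_nat_into[OF ne, of n] \<B>(2) by (auto simp: G_def \<G>_def)
  define R where "R n A d \<longleftrightarrow> nbhd A \<and> 0 < d \<and>
    {v \<in> D. v - 0 \<in> A \<and> snorm (v - 0) < d} \<subseteq> G n" for n and A :: "'v set" and d :: real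
  have "\<exists>A d. R n A d" for n
    using G[of n] unfolding R_def form_open_def by blast
  then obtain W e where "\<And>n. R n (W n) (e n)"
    by metis
  then have We: "nbhd (W n)" "0 < e n"
    "{v \<in> D. v - 0 \<in> W n \<and> snorm (v - 0) < e n} \<subseteq> G n" for n
    by (auto simp: R_def)
  \<comment> \<open>Being inside \<open>W n\<close> makes \<open>U n\<close>, together with the
    radius \<open>e n\<close>, cut out a part of the base set \<open>G n\<close>; being inside
    \<open>V\<close> gives the bound on \<open>U 0\<close>.\<close>
  define P where "P n A \<longleftrightarrow> nbhd A \<and> (\<forall>x\<in>A. - x \<in> A) \<and> A \<subseteq> V \<inter> W n" for n A
  have half: "\<exists>A'. P n A' \<and> (\<forall>x\<in>A'. \<forall>y\<in>A'. x + y \<in> A)" if "nbhd A" for A n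
  proof -
    have "nbhd (A \<inter> (V \<inter> W n))"
      using that assms(2) We(1) by (intro nbhd_Int)
    then obtain A' where A': "nbhd A'" "\<And>x. x \<in> A' \<Longrightarrow> - x \<in> A'"
      "\<And>x y. x \<in> A' \<Longrightarrow> y \<in> A' \<Longrightarrow> x + y \<in> A \<inter> (V \<inter> W n)"
      by (rule nbhd_half) blast
    moreover have "A' \<subseteq> V \<inter> W n"
      using A'(3)[of _ 0] A'(1) by (auto simp: nbhd_def)
    ultimately show ?thesis
      unfolding P_def by blast
  qed
  have "\<exists>U. \<forall>n. P n (U n) \<and> (\<forall>x\<in>U (Suc n). \<forall>y\<in>U (Suc n). x + y \<in> U n)"
  proof (rule dependent_nat_choice)
    show "\<exists>A. P 0 A"
      using half[OF nbhd_UNIV] by blast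
    show "\<exists>A'. P (Suc n) A' \<and> (\<forall>x\<in>A'. \<forall>y\<in>A'. x + y \<in> A)" if "P n A" for A n
      using half[of A "Suc n"] that unfolding P_def by blast
  qed
  then obtain U where U: "\<And>n. P n (U n)" "\<And>n. \<forall>x\<in>U (Suc n). \<forall>y\<in>U (Suc n). x + y \<in> U n"
    by blast
  have base: "\<exists>k e. 0 < e \<and> (\<forall>x\<in>D \<inter> U k. snorm x < e \<longrightarrow> x \<in> S)" if S: "nbhd S" for S
  proof -
    have "form_open {v \<in> D. v - 0 \<in> S \<and> snorm (v - 0) < 1}"
      using openin_form_basic[OF S zero_less_one D_0] by (simp only: openin_form_topology)
    moreover have "0 \<in> {v \<in> D. v - 0 \<in> S \<and> snorm (v - 0) < 1}"
      using S D_0 by (simp add: nbhd_def snorm_0)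
    ultimately obtain H where H: "H \<in> \<G>" "H \<subseteq> {v \<in> D. v - 0 \<in> S \<and> snorm (v - 0) < 1}"
      using \<B>(3) unfolding \<G>_def by blast
    then obtain k where "H = G k"
      using from_nat_into_surj[OF cnt] unfolding G_def by metis
    then have "\<forall>x\<in>D \<inter> U k. snorm x < e k \<longrightarrow> x \<in> S"
      using We(3)[of k] U(1)[of k] H(2) unfolding P_def by auto
    then show ?thesis
      using We(2) by blast
  qed
  have "string_base U"
    unfolding string_base_def using U base by (auto simp: P_def)
  moreover have "U 0 \<subseteq> V"
    using U(1)[of 0] by (simp add: P_def)
  ultimately show thesis
    by (rule that)
qed

text \<open>Peel off the first increment: it lies in \<open>U (Suc n)\<close>, and so does the rest
  by induction, hence their sum lies in \<open>U n\<close>. For this \<open>n\<close> must vary in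
  the induction.\<close>

lemma string_base_telescope:
  assumes "string_base U" "\<And>n. x (Suc n) - x n \<in> U (Suc n)"
  shows "x (n + p) - x n \<in> U n"
proof (induction p arbitrary: n)
  case 0
  then show ?case using string_baseD(2)[OF assms(1)] by simp
next
  case (Suc p)
  have "(x (Suc n) - x n) + (x (Suc n + p) - x (Suc n)) \<in> U n"
    by (intro string_baseD(4)[OF assms(1)] assms(2) Suc.IH)
  then show ?case by simp
qed

text \<open>The bound is the geometric series from index \<open>n\<close> on; removing its first
  term leaves exactly the bound for \<open>Suc n\<close>.\<close>

lemma snorm_telescope:
  assumes "\<And>n. x n \<in> D" "\<And>n. snorm (x (Suc n) - x n) \<le> (1/2) ^ n"
  shows "snorm (x (n + p) - x n) \<le> 2 * (1/2) ^ n"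
proof (induction p arbitrary: n)
  case 0
  then show ?case by (simp add: snorm_0)
next
  case (Suc p)
  have "snorm (x (Suc n + p) - x n) \<le> snorm (x (Suc n + p) - x (Suc n)) + snorm (x (Suc n) - x n)"
    by (intro snorm_triangle_via assms(1))
  also have "\<dots> \<le> 2 * (1/2) ^ Suc n + (1/2) ^ n"
    by (intro add_mono Suc.IH assms(2))
  finally show ?case by simp
qed

text \<open>The common tool of the lifting argument and of successive approximation: the increments
  are summable both along the string and in the seminorm, so the image filter of the sequence is
  Cauchy in the form topology.\<close>

lemma fast_Cauchy_converges:
  assumes closed: "closed_form T q" and U: "string_base U"
    and x: "\<And>n. x n \<in> D" "\<And>n. x (Suc n) - x n \<in> U (Suc n)"
      "\<And>n. snorm (x (Suc n) - x n) \<le> (1/2) ^ n"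
  obtains l where "l \<in> D" "limitin (form_topology T q) x l sequentially"
proof -
  have close: "x i - x j \<in> U K \<and> snorm (x i - x j) \<le> 2 * (1/2) ^ K" if "K \<le> i" "K \<le> j" for i j K
  proof -
    have *: "x (n + p) - x n \<in> U K \<and> snorm (x (n + p) - x n) \<le> 2 * (1/2) ^ K" if "K \<le> n" for n p
    proof
      show "x (n + p) - x n \<in> U K"
        using string_base_telescope[OF U x(2)] string_base_antimono[OF U that] by blast
      have "(1/2::real) ^ n \<le> (1/2) ^ K"
        using that by (intro power_decreasing) auto
      then show "snorm (x (n + p) - x n) \<le> 2 * (1/2) ^ K"
        using snorm_telescope[OF x(1,3), of n p] by linarith
    qed
    show ?thesis
    proof (cases "j \<le> i")
      case True
      then show ?thesis using *[of j "i - j"] that by simp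
    next
      case False
      then have "x j - x i \<in> U K \<and> snorm (x j - x i) \<le> 2 * (1/2) ^ K"
        using *[of i "j - i"] that by simp
      then show ?thesis
        using string_baseD(3)[OF U, of "x j - x i" K] by (simp add: snorm_minus_commute)
    qed
  qed
  let ?F = "filtermap x sequentially"
  have "vector_cauchy_filter (form_topology T q) ?F"
    unfolding vector_cauchy_filter_form_topology_iff
  proof (intro allI impI)
    fix W and e :: real assume "nbhd W" "0 < e"
    \<comment> \<open>\<open>W\<close> is reached through \<open>U k\<close> and the radius
      \<open>d\<close> together, so the index \<open>K\<close> below must serve \<open>k\<close> as
      well as both \<open>d\<close> and \<open>e\<close>.\<close>
    then obtain k d where d: "0 < d" "\<And>z. z \<in> D \<inter> U k \<Longrightarrow> snorm z < d \<Longrightarrow> z \<in> W"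
      using U unfolding string_base_def by metis
    have "0 < min d e / 2"
      using d(1) \<open>0 < e\<close> by simp
    then obtain M where M: "(1/2::real) ^ M < min d e / 2"
      using real_arch_pow_inv[of "min d e / 2" "1/2"] by auto
    define K where "K = max k M"
    have "(1/2::real) ^ K \<le> (1/2) ^ M"
      unfolding K_def by (intro power_decreasing) auto
    then have K: "2 * (1/2) ^ K < min d e"
      using M by linarith
    have good: "x i - x j \<in> D \<and> x i - x j \<in> W \<and> snorm (x i - x j) < e"
      if "K \<le> i" "K \<le> j" for i j
    proof -
      have "x i - x j \<in> U k"
        using close[OF that] string_base_antimono[OF U, of k K] by (auto simp: K_def)
      moreover have "snorm (x i - x j) < min d e"
        using close[OF that] K by linarith
      ultimately show ?thesis
        using d(2)[of "x i - x j"] x(1) by (auto simp: D_intros)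
    qed
    have ev: "\<forall>\<^sub>F z in ?F. \<exists>n\<ge>K. z = x n"
      unfolding eventually_filtermap by (rule eventually_sequentiallyI[of K]) blast
    show "\<forall>\<^sub>F (x, y) in ?F \<times>\<^sub>F ?F. x - y \<in> D \<and> x - y \<in> W \<and> snorm (x - y) < e"
      unfolding eventually_prod_filter using ev good by fastforce
  qed
  moreover have "?F \<le> principal (topspace (form_topology T q))"
    using x(1) by (simp add: le_principal eventually_filtermap topspace_form_topology)
  moreover have "?F \<noteq> bot"
    by (simp add: filtermap_bot_iff)
  ultimately obtain l where "limitin (form_topology T q) (\<lambda>x. x) l ?F"
    using closed unfolding closed_form_def vector_complete_def by blast
  then show thesis
    by (intro that[of l]) (auto simp: limitin_form_topology_iff eventually_filtermap)
qed

text \<open>Translation reduces continuity to the class of \<open>0\<close>, and a neighbourhood of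
  that class pulls back to a set \<open>W + N\<close>. Later proofs use this form of continuity
  only.\<close>

lemma form_embedding_continuous_iff:
  "form_embedding_continuous T q \<longleftrightarrow>
    (\<forall>W. nbhd W \<longrightarrow> (\<exists>e>0. \<forall>u\<in>D. snorm u < e \<longrightarrow> (\<exists>n\<in>N. u - n \<in> W)))"
proof
  assume cont: "form_embedding_continuous T q"
  show "\<forall>W. nbhd W \<longrightarrow> (\<exists>e>0. \<forall>u\<in>D. snorm u < e \<longrightarrow> (\<exists>n\<in>N. u - n \<in> W))"
  proof (intro allI impI)
    fix W assume W: "nbhd W"
    define \<U> where "\<U> = (\<lambda>w. w +o N) ` W"
    have mem: "u +o N \<in> \<U> \<longleftrightarrow> (\<exists>n\<in>N. u - n \<in> W)" for u
    proof
      assume "u +o N \<in> \<U>"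
      then obtain w where "w \<in> W" "u - w \<in> N"
        by (auto simp: \<U>_def coset_eq_iff)
      then show "\<exists>n\<in>N. u - n \<in> W"
        by (intro bexI[of _ "u - w"]) auto
    next
      assume "\<exists>n\<in>N. u - n \<in> W"
      then obtain n where "n \<in> N" "u - n \<in> W" by blast
      then show "u +o N \<in> \<U>"
        unfolding \<U>_def by (intro image_eqI[of _ _ "u - n"]) (simp_all add: coset_eq_iff)
    qed
    \<comment> \<open>The image of \<open>W\<close> is open in the quotient because its preimage is
      a union of translates of \<open>W\<close>.\<close>
    have "{u. u +o N \<in> \<U>} = (\<Union>n\<in>N. {u. u - n \<in> W})"
      by (auto simp: mem)
    then have "openin T {u. u +o N \<in> \<U>}"
      using openin_translate_nbhd[OF W] by auto
    moreover have "\<U> \<subseteq> quotient_set UNIV N"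
      by (auto simp: \<U>_def quotient_set_def)
    ultimately have "openin (quotient_topology T N) \<U>"
      by (simp add: openin_quotient_topology)
    then have "openin quot.mtopology {A \<in> form_quotient q. A \<in> \<U>}"
      using cont openin_continuous_map_preimage
      unfolding form_embedding_continuous_def form_quotient_topology_eq by fastforce
    moreover have "0 +o N \<in> {A \<in> form_quotient q. A \<in> \<U>}"
      using coset_in_form_quotient[OF D_0] W unfolding mem mem_Collect_eq
      by (auto simp: nbhd_def intro: bexI[OF _ N_intros(1)])
    ultimately obtain e where e: "e > 0" "quot.mball (0 +o N) e \<subseteq> {A \<in> form_quotient q. A \<in> \<U>}"
      unfolding quot.openin_mtopology by blast
    have "\<exists>n\<in>N. u - n \<in> W" if "u \<in> D" "snorm u < e" for u
    proof -
      have "u +o N \<in> quot.mball (0 +o N) e"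
        using that by (simp only: coset_mball_iff D_0 diff_zero)
      then show ?thesis
        using e(2) mem by blast
    qed
    with e(1) show "\<exists>e>0. \<forall>u\<in>D. snorm u < e \<longrightarrow> (\<exists>n\<in>N. u - n \<in> W)"
      by blast
  qed
next
  assume *: "\<forall>W. nbhd W \<longrightarrow> (\<exists>e>0. \<forall>u\<in>D. snorm u < e \<longrightarrow> (\<exists>n\<in>N. u - n \<in> W))"
  show "form_embedding_continuous T q"
    unfolding form_embedding_continuous_def form_quotient_topology_eq continuous_map_def
  proof (intro conjI allI impI)
    show "(\<lambda>A. A) \<in> topspace quot.mtopology \<rightarrow> topspace (quotient_topology T N)"
      by (auto simp: topspace_quotient_topology quotient_set_def elim: form_quotient_cases)
    fix \<U> assume "openin (quotient_topology T N) \<U>"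
    then have op: "openin T {u. u +o N \<in> \<U>}"
      by (simp add: openin_quotient_topology)
    show "openin quot.mtopology {A \<in> topspace quot.mtopology. A \<in> \<U>}"
      unfolding quot.openin_mtopology
    proof (intro conjI allI impI)
      fix A assume "A \<in> {A \<in> topspace quot.mtopology. A \<in> \<U>}"
      then obtain u where u: "u \<in> D" "A = u +o N" "u +o N \<in> \<U>"
        by (auto elim: form_quotient_cases)
      have "nbhd {x. x + u \<in> {u. u +o N \<in> \<U>}}"
        using op u(3) by (intro nbhd_translation) auto
      then obtain e where e: "e > 0"
        "\<And>v. v \<in> D \<Longrightarrow> snorm v < e \<Longrightarrow> \<exists>n\<in>N. v - n \<in> {x. x + u \<in> {u. u +o N \<in> \<U>}}"
        using * by meson
      have "quot.mball A e \<subseteq> {A \<in> topspace quot.mtopology. A \<in> \<U>}"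
      proof
        fix X assume X: "X \<in> quot.mball A e"
        then have "X \<in> form_quotient q"
          by simp
        then obtain v where v: "v \<in> D" "X = v +o N"
          by (rule form_quotient_cases)
        then have "snorm (v - u) < e"
          using X u coset_mball_iff by blast
        then obtain n where n: "n \<in> N" "(v - u - n + u) +o N \<in> \<U>"
          using e(2)[of "v - u"] u v by (auto simp: D_intros)
        have "(v - u - n + u) +o N = v +o N"
          using N_intros(5)[OF n(1)] by (simp add: coset_eq_iff)
        with n v show "X \<in> {A \<in> topspace quot.mtopology. A \<in> \<U>}"
          by (simp add: coset_in_form_quotient)
      qed
      with e(1) show "\<exists>r>0. quot.mball A r \<subseteq> {A \<in> topspace quot.mtopology. A \<in> \<U>}"
        by blast
    qed auto
  qed
qed

subsection \<open>Closedness, completeness and the canonical embedding\<close>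

text \<open>The seminorm vanishes on \<open>N\<close>, so a filter on \<open>N\<close> converging in
  \<open>T\<close> is Cauchy in the form topology. Its form limit lies in \<open>N\<close> and is
  the given limit, as \<open>T\<close> is Hausdorff.\<close>

lemma kernel_closedin:
  assumes closed: "closed_form T q"
  shows "closedin T N"
proof (rule closedin_if_approx)
  fix v assume approx: "\<And>W. nbhd W \<Longrightarrow> \<exists>n\<in>N. n - v \<in> W"
  \<comment> \<open>The trace on \<open>N\<close> of the neighbourhood filter of \<open>v\<close>;
    it is proper because \<open>v\<close> is approximated by points of \<open>N\<close>.\<close>
  define F where "F = inf (nhdsin T v) (principal N)"
  have evF: "eventually P F \<longleftrightarrow> (\<exists>S. openin T S \<and> v \<in> S \<and> (\<forall>x\<in>S. x \<in> N \<longrightarrow> P x))" for P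
    by (simp add: F_def eventually_inf_principal eventually_nhdsin)
  have near: "\<forall>\<^sub>F x in F. x \<in> N \<and> x - v \<in> W" if "nbhd W" for W
    unfolding evF using that openin_translate_nbhd[OF that, of v]
    by (intro exI[of _ "{x. x - v \<in> W}"]) (auto simp: nbhd_def)
  have "F \<noteq> bot"
  proof
    assume "F = bot"
    then have "\<forall>\<^sub>F x in F. False" by simp
    then obtain S where S: "openin T S" "v \<in> S" "\<forall>x\<in>S. x \<notin> N"
      unfolding evF by blast
    have "nbhd {x. x + v \<in> S}"
      using S by (intro nbhd_translation)
    from approx[OF this] S(3) show False by auto
  qed
  moreover have "F \<le> principal (topspace (form_topology T q))"
    unfolding le_principal topspace_form_topology
    using near[OF nbhd_UNIV] by (rule eventually_mono) (simp add: N_subset_D)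
  moreover have "vector_cauchy_filter (form_topology T q) F"
    unfolding vector_cauchy_filter_form_topology_iff
  proof (intro allI impI)
    fix W and e :: real assume "nbhd W" "0 < e"
    obtain W' where W': "nbhd W'" "\<And>x. x \<in> W' \<Longrightarrow> - x \<in> W'"
      "\<And>x y. x \<in> W' \<Longrightarrow> y \<in> W' \<Longrightarrow> x + y \<in> W"
      using nbhd_half[OF \<open>nbhd W\<close>] by blast
    have "x - y \<in> D \<and> x - y \<in> W \<and> snorm (x - y) < e"
      if "x \<in> N \<and> x - v \<in> W'" "y \<in> N \<and> y - v \<in> W'" for x y
    proof -
      have "x - y \<in> N"
        using that by (simp add: N_intros)
      moreover have "(x - v) + - (y - v) \<in> W"
        using that by (intro W') auto
      ultimately show ?thesis
        using \<open>0 < e\<close> by (simp add: N_iff)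
    qed
    then show "\<forall>\<^sub>F (x, y) in F \<times>\<^sub>F F. x - y \<in> D \<and> x - y \<in> W \<and> snorm (x - y) < e"
      unfolding eventually_prod_filter using near[OF W'(1)] by fastforce
  qed
  ultimately obtain l where "limitin (form_topology T q) (\<lambda>x. x) l F"
    using closed unfolding closed_form_def vector_complete_def by blast
  then have l: "l \<in> D" "\<And>W e. nbhd W \<Longrightarrow> 0 < e \<Longrightarrow>
      \<forall>\<^sub>F x in F. x \<in> D \<and> x - l \<in> W \<and> snorm (x - l) < e"
    by (auto simp: limitin_form_topology_iff)
  \<comment> \<open>Every \<open>x\<close> in \<open>N\<close> satisfies
    \<open>snorm (x - l) = snorm l\<close>, so \<open>F\<close> could not enter the ball of radius
    \<open>snorm l\<close> around \<open>l\<close> if this radius were positive.\<close>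
  have "snorm l = 0"
  proof (rule ccontr)
    assume "snorm l \<noteq> 0"
    then have "0 < snorm l"
      using snorm_nonneg[of l] by simp
    from eventually_conj[OF l(2)[OF nbhd_UNIV this] near[OF nbhd_UNIV]]
    have "\<forall>\<^sub>F x in F. False"
    proof (rule eventually_mono)
      fix x assume "(x \<in> D \<and> x - l \<in> UNIV \<and> snorm (x - l) < snorm l) \<and> x \<in> N \<and> x - v \<in> UNIV"
      then show False
        using snorm_add_N[of "- l" x] l(1) by (simp add: D_minus snorm_minus)
    qed
    with \<open>F \<noteq> bot\<close> show False
      by simp
  qed
  moreover have "limitin T (\<lambda>x. x) l F"
    unfolding limitin_iff_nbhd
  proof (intro allI impI)
    fix W assume "nbhd W"
    from l(2)[OF this zero_less_one] show "\<forall>\<^sub>F x in F. x - l \<in> W"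
      by (rule eventually_mono) simp
  qed
  moreover have "limitin T (\<lambda>x. x) v F"
    unfolding limitin_iff_nbhd
  proof (intro allI impI)
    fix W assume "nbhd W"
    from near[OF this] show "\<forall>\<^sub>F x in F. x - v \<in> W"
      by (rule eventually_mono) simp
  qed
  ultimately show "v \<in> N"
    using limitin_Hausdorff_unique[OF _ _ \<open>F \<noteq> bot\<close> Hausdorff] l(1) N_iff by metis
qed

text \<open>Baire: the cosets of the multiples \<open>(n + 1) W'\<close> cover \<open>D / N\<close>, so the closure of one of these
  images has an interior point; taking differences moves that point to the origin.\<close>

lemma almost_open:
  assumes complete: "quot.mcomplete" and W: "nbhd W"
  obtains e where "0 < e"
    "\<And>u d. u \<in> D \<Longrightarrow> snorm u < e \<Longrightarrow> 0 < d \<Longrightarrow> \<exists>b\<in>D \<inter> W. snorm (u - b) < d"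
proof -
  obtain W' where W': "nbhd W'" "\<And>x. x \<in> W' \<Longrightarrow> - x \<in> W'"
    "\<And>x y. x \<in> W' \<Longrightarrow> y \<in> W' \<Longrightarrow> x + y \<in> W"
    using nbhd_half[OF W] by blast
  \<comment> \<open>Using \<open>Suc n\<close> keeps the factor positive, so that it can be divided
    out at the end.\<close>
  define S where "S n = (\<lambda>b. (real (Suc n) *\<^sub>R b) +o N) ` (D \<inter> W')" for n
  define C where "C n = quot.mtopology closure_of S n" for n
  have S: "S n \<subseteq> form_quotient q" for n
    unfolding S_def using coset_in_form_quotient[OF D_scaleR] by blast
  have cover: "form_quotient q \<subseteq> (\<Union>n. C n)"
  proof
    fix A assume "A \<in> form_quotient q"
    then obtain u where u: "u \<in> D" "A = u +o N"
      by (rule form_quotient_cases)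
    obtain m where m: "m > 0" "(1 / real m) *\<^sub>R u \<in> W'"
      using nbhd_absorbing[OF W'(1)] by blast
    have "A = (real (Suc (m - 1)) *\<^sub>R ((1 / real m) *\<^sub>R u)) +o N"
      using m(1) u(2) by simp
    then have "A \<in> S (m - 1)"
      unfolding S_def using m(2) D_scaleR[OF u(1)] by blast
    then have "A \<in> C (m - 1)"
      unfolding C_def using closure_of_subset[of "S (m - 1)" quot.mtopology] S by auto
    then show "A \<in> (\<Union>n. C n)"
      by blast
  qed
  have "\<exists>n. quot.mtopology interior_of (C n) \<noteq> {}"
  proof (rule ccontr)
    assume "\<not> ?thesis"
    then have "quot.mtopology interior_of \<Union>(range C) = {}"
      by (intro quot.metric_Baire_category_alt[OF complete]) (auto simp: C_def)
    moreover have "\<Union>(range C) = topspace quot.mtopology"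
      using cover closure_of_subset_topspace[of quot.mtopology] by (fastforce simp: C_def)
    ultimately show False
      using coset_in_form_quotient[OF D_0] interior_of_topspace[of quot.mtopology] by simp
  qed
  then obtain n A where "A \<in> quot.mtopology interior_of (C n)"
    by blast
  then obtain G where G: "openin quot.mtopology G" "A \<in> G" "G \<subseteq> C n"
    by (auto simp: interior_of_def)
  then obtain r where r: "r > 0" "quot.mball A r \<subseteq> C n"
    unfolding quot.openin_mtopology by blast
  have "A \<in> form_quotient q"
    using G openin_subset by fastforce
  then obtain p where p: "p \<in> D" "A = p +o N"
    by (rule form_quotient_cases)
  define m where "m = real (Suc n)"
  have m: "m > 0"
    by (simp add: m_def)
  have approx: "\<exists>b\<in>D \<inter> W'. snorm (v - m *\<^sub>R b) < d"
    if v: "v \<in> D" "snorm (v - p) < r" and "0 < d" for v d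
  proof -
    have "v +o N \<in> quot.mball A r"
      using v p by (simp add: coset_mball_iff del: quot.in_mball)
    then have "v +o N \<in> C n"
      using r(2) by blast
    then obtain X where "X \<in> S n" "X \<in> quot.mball (v +o N) d"
      unfolding C_def quot.metric_closure_of using \<open>0 < d\<close> by blast
    then obtain b where "b \<in> D \<inter> W'" "(m *\<^sub>R b) +o N \<in> quot.mball (v +o N) d"
      unfolding S_def m_def by blast
    moreover from this have "snorm (m *\<^sub>R b - v) < d"
      using v(1) coset_mball_iff[of v "m *\<^sub>R b"] by (simp add: D_scaleR del: quot.in_mball)
    ultimately show ?thesis
      by (auto simp: snorm_minus_commute)
  qed
  \<comment> \<open>Both \<open>m *\<^sub>R u + p\<close> and \<open>p\<close> lie in the ball of
    radius \<open>r\<close> around \<open>p\<close>. Approximating each within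
    \<open>m * d / 2\<close> and subtracting cancels \<open>p\<close>; division by \<open>m\<close>
    leaves the error below \<open>d\<close>.\<close>
  have main: "\<exists>b\<in>D \<inter> W. snorm (u - b) < d" if u: "u \<in> D" "snorm u < r / m" and d: "0 < d" for u d
  proof -
    have "snorm (m *\<^sub>R u + p - p) < r"
      using u m by (simp add: snorm_scaleR field_simps)
    moreover have "m *\<^sub>R u + p \<in> D"
      using u p by (simp add: D_intros)
    ultimately obtain b1 where b1: "b1 \<in> D \<inter> W'" "snorm (m *\<^sub>R u + p - m *\<^sub>R b1) < m * d / 2"
      using approx[of "m *\<^sub>R u + p" "m * d / 2"] d m by auto
    obtain b2 where b2: "b2 \<in> D \<inter> W'" "snorm (p - m *\<^sub>R b2) < m * d / 2"
      using approx[of p "m * d / 2"] d m p r(1) by (auto simp: snorm_0)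
    have "m * snorm (u - (b1 - b2)) = snorm (m *\<^sub>R (u - (b1 - b2)))"
      using m by (simp add: snorm_scaleR)
    also have "m *\<^sub>R (u - (b1 - b2)) = (m *\<^sub>R u + p - m *\<^sub>R b1) - (p - m *\<^sub>R b2)"
      by (simp add: algebra_simps)
    also have "snorm \<dots> \<le> snorm (m *\<^sub>R u + p - m *\<^sub>R b1) + snorm (p - m *\<^sub>R b2)"
      using b1 b2 u p by (intro snorm_triangle_diff D_intros) auto
    also have "\<dots> < m * d"
      using b1 b2 by simp
    finally have "snorm (u - (b1 - b2)) < d"
      using m by simp
    moreover have "b1 + - b2 \<in> W"
      using b1 b2 by (intro W') auto
    ultimately show ?thesis
      using b1 b2 by (intro bexI[of _ "b1 - b2"]) (auto simp: D_intros)
  qed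
  show thesis
    by (rule that[of "r / m"]) (use r(1) m main in auto)
qed

text \<open>\<open>almost_open\<close> is applied to the remainder at each stage with the next set
  of the string. The corrections add up inside \<open>U 0\<close>, and the limit \<open>l\<close> of
  the partial sums lies in the class of \<open>u\<close>.\<close>

lemma closed_hilbert_imp_embedding_continuous:
  assumes closed: "closed_form T q" and complete: "quot.mcomplete"
    and metrizable: "metrizable_space (form_topology T q)"
  shows "form_embedding_continuous T q"
  unfolding form_embedding_continuous_iff
proof (intro allI impI)
  fix W assume "nbhd W"
  then obtain W' where W': "nbhd W'" "\<And>x. x \<in> W' \<Longrightarrow> - x \<in> W'"
    "\<And>x y. x \<in> W' \<Longrightarrow> y \<in> W' \<Longrightarrow> x + y \<in> W"
    using nbhd_half by blast
  obtain U where U: "string_base U" "U 0 \<subseteq> W'"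
    using string_base_exists[OF metrizable W'(1)] by blast
  have "\<exists>e>0. \<forall>u\<in>D. snorm u < e \<longrightarrow> (\<forall>d>0. \<exists>b\<in>D \<inter> U (Suc n). snorm (u - b) < d)" for n
    using almost_open[OF complete string_baseD(1)[OF U(1)], of "Suc n"] by metis
  then obtain s where s: "\<And>n. s n > 0"
    "\<And>n u d. u \<in> D \<Longrightarrow> snorm u < s n \<Longrightarrow> 0 < d \<Longrightarrow> \<exists>b\<in>D \<inter> U (Suc n). snorm (u - b) < d"
    by metis
  \<comment> \<open>\<open>s n\<close> permits the next use of \<open>almost_open\<close>; the
    second bound gives \<open>t (Suc n) + t n \<le> (1/2) ^ n\<close>, as
    \<open>fast_Cauchy_converges\<close> requires.\<close>
  define t where "t n = min (s n) ((1/2) ^ n / 2)" for n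
  have t: "0 < t n" "t n \<le> s n" "t n \<le> (1/2) ^ n / 2" for n
    using s(1)[of n] by (auto simp: t_def)
  have "\<exists>n\<in>N. u - n \<in> W" if u: "u \<in> D" "snorm u < t 0" for u
  proof -
    \<comment> \<open>The last clause starts the recursion at \<open>0\<close>, so that telescoping
      yields \<open>y n \<in> U 0\<close>.\<close>
    define P where "P n y \<longleftrightarrow> y \<in> D \<and> snorm (u - y) < t n \<and> (n = 0 \<longrightarrow> y = 0)" for n y
    have "\<exists>y. \<forall>n. P n (y n) \<and> y (Suc n) - y n \<in> U (Suc n)"
    proof (rule dependent_nat_choice)
      show "\<exists>y. P 0 y"
        using u D_0 by (auto simp: P_def)
      fix y n assume y: "P n y"
      then have "u - y \<in> D" "snorm (u - y) < s n"
        using u(1) t(2)[of n] by (auto simp: P_def D_intros)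
      then obtain b where b: "b \<in> D \<inter> U (Suc n)" "snorm (u - y - b) < t (Suc n)"
        using s(2) t(1) by blast
      have "P (Suc n) (y + b) \<and> (y + b) - y \<in> U (Suc n)"
        using y b by (auto simp: P_def D_intros diff_diff_eq)
      then show "\<exists>y'. P (Suc n) y' \<and> y' - y \<in> U (Suc n)"
        by blast
    qed
    then obtain y where y: "\<And>n. P n (y n)" "\<And>n. y (Suc n) - y n \<in> U (Suc n)"
      by blast
    have yD: "y n \<in> D" "snorm (u - y n) < t n" for n
      using y(1)[of n] by (auto simp: P_def)
    have y0: "y 0 = 0"
      using y(1)[of 0] by (simp add: P_def)
    have "snorm (y (Suc n) - y n) \<le> (1/2) ^ n" for n
    proof -
      have "snorm (y (Suc n) - y n) \<le> snorm (y (Suc n) - u) + snorm (u - y n)"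
        by (intro snorm_triangle_via yD u)
      also have "\<dots> \<le> t (Suc n) + t n"
        using yD(2)[of n] yD(2)[of "Suc n"] by (simp add: snorm_minus_commute)
      also have "\<dots> \<le> (1/2) ^ Suc n / 2 + (1/2) ^ n / 2"
        using t(3) by (intro add_mono)
      also have "\<dots> \<le> (1/2) ^ n"
        by (simp add: field_simps)
      finally show ?thesis .
    qed
    then obtain l where l: "l \<in> D" "limitin (form_topology T q) y l sequentially"
      using fast_Cauchy_converges[OF closed U(1) yD(1) y(2)] by blast
    have ev: "\<forall>\<^sub>F n in sequentially. y n \<in> D \<and> y n - l \<in> V \<and> snorm (y n - l) < e"
      if "nbhd V" "0 < e" for V e
      using l(2) that by (auto simp: limitin_form_topology_iff)
    have "snorm (u - l) = 0"
    proof (rule ccontr)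
      assume "snorm (u - l) \<noteq> 0"
      then have pos: "0 < snorm (u - l) / 2"
        using snorm_nonneg[of "u - l"] by simp
      have "(\<lambda>n. (1/2::real) ^ n) \<longlonglongrightarrow> 0"
        by (rule LIMSEQ_power_zero) simp
      then have "\<forall>\<^sub>F n in sequentially. (1/2::real) ^ n < snorm (u - l)"
        using pos by (intro order_tendstoD(2)) auto
      then have "\<forall>\<^sub>F n in sequentially. False"
        using ev[OF nbhd_UNIV pos]
      proof eventually_elim
        case (elim n)
        then show ?case
          using snorm_triangle_via[OF u(1) yD(1)[of n] l(1)] yD(2)[of n] t(3)[of n] by linarith
      qed
      then show False by simp
    qed
    then have "u - l \<in> N"
      using u l by (simp add: N_iff D_intros)
    moreover have "l \<in> W"
    proof -
      \<comment> \<open>\<open>U 0\<close> was placed inside the half \<open>W'\<close> of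
        \<open>W\<close> because \<open>l\<close> is a difference of two of its points,
        \<open>y n\<close> and \<open>y n - l\<close>.\<close>
      obtain n where n: "y n - l \<in> U 0"
        using eventually_happens'[OF _ ev[OF string_baseD(1)[OF U(1), of 0] zero_less_one]] by auto
      have "y n \<in> U 0"
        using string_base_telescope[OF U(1) y(2), of 0 n] y0 by simp
      then have "y n + - (y n - l) \<in> W"
        using n U(2) by (intro W') auto
      then show ?thesis by simp
    qed
    ultimately show ?thesis
      by (intro bexI[of _ "u - l"]) auto
  qed
  then show "\<exists>e>0. \<forall>u\<in>D. snorm u < e \<longrightarrow> (\<exists>n\<in>N. u - n \<in> W)"
    using t(1)[of 0] by blast
qed

text \<open>A Cauchy sequence converges once a subsequence does, so only a fast subsequence is
  lifted, by choosing representatives one after the other.\<close>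

lemma closed_embedding_continuous_imp_hilbert:
  assumes closed: "closed_form T q" and emb: "form_embedding_continuous T q"
    and metrizable: "metrizable_space (form_topology T q)"
  shows "quot.mcomplete"
  unfolding quot.mcomplete_def
proof (intro allI impI)
  fix \<sigma> assume Cauchy: "quot.MCauchy \<sigma>"
  obtain U where U: "string_base U"
    using string_base_exists[OF metrizable nbhd_UNIV] by blast
  have "\<exists>e>0. \<forall>u\<in>D. snorm u < e \<longrightarrow> (\<exists>n\<in>N. u - n \<in> U (Suc k))" for k
    using emb string_baseD(1)[OF U] unfolding form_embedding_continuous_iff by blast
  then obtain s where s: "\<And>k. s k > 0"
    "\<And>k u. u \<in> D \<Longrightarrow> snorm u < s k \<Longrightarrow> \<exists>n\<in>N. u - n \<in> U (Suc k)"
    by metis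
  \<comment> \<open>\<open>s k\<close> allows a correction of the increment into
    \<open>U (Suc k)\<close>; \<open>(1/2) ^ k\<close> makes the increments summable.\<close>
  define t where "t k = min (s k) ((1/2) ^ k)" for k
  have t: "0 < t k" "t k \<le> s k" "t k \<le> (1/2) ^ k" for k
    using s(1)[of k] by (auto simp: t_def)
  \<comment> \<open>All later terms stay within \<open>t k\<close> of \<open>\<sigma> M\<close>, so
    consecutive terms of the subsequence are close no matter how far apart their indices
    are.\<close>
  define Q where "Q k M \<longleftrightarrow> (\<forall>n\<ge>M. coset_dist (\<sigma> M) (\<sigma> n) < t k)" for k M
  have "\<exists>r. \<forall>k. Q k (r k) \<and> r k < r (Suc k)"
  proof (rule dependent_nat_choice)
    have ex: "\<exists>M>m. Q k M" for k m
    proof -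
      obtain M where M: "\<And>n n'. M \<le> n \<Longrightarrow> M \<le> n' \<Longrightarrow> coset_dist (\<sigma> n) (\<sigma> n') < t k"
        using Cauchy t(1) unfolding quot.MCauchy_def by metis
      have "Q k (max M (Suc m))"
        unfolding Q_def using M by auto
      then show ?thesis
        by (intro exI[of _ "max M (Suc m)"]) simp
    qed
    show "\<exists>M. Q 0 M" "\<exists>M'. Q (Suc k) M' \<and> M < M'" for k M
      using ex by blast+
  qed
  then obtain r where r: "\<And>k. Q k (r k)" "\<And>k. r k < r (Suc k)"
    by blast
  then have mono: "strict_mono r"
    by (simp add: strict_mono_Suc_iff)
  have dist: "coset_dist (\<sigma> (r k)) (\<sigma> (r (Suc k))) < t k" for k
    using r(1)[of k] r(2)[of k] unfolding Q_def by simp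
  have \<sigma>: "\<sigma> n \<in> form_quotient q" for n
    using Cauchy unfolding quot.MCauchy_def by blast
  have "\<exists>x. \<forall>k. (x k \<in> D \<and> \<sigma> (r k) = x k +o N) \<and>
      (x (Suc k) - x k \<in> U (Suc k) \<and> snorm (x (Suc k) - x k) < t k)"
  proof (rule dependent_nat_choice)
    show "\<exists>x. x \<in> D \<and> \<sigma> (r 0) = x +o N"
      using \<sigma>[of "r 0"] by (auto elim: form_quotient_cases)
    fix x k assume x: "x \<in> D \<and> \<sigma> (r k) = x +o N"
    obtain y where y: "y \<in> D" "\<sigma> (r (Suc k)) = y +o N"
      using \<sigma>[of "r (Suc k)"] by (rule form_quotient_cases)
    have xy: "snorm (y - x) < t k" "y - x \<in> D"
      using dist[of k] x y by (auto simp: coset_dist_coset snorm_minus_commute D_intros)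
    \<comment> \<open>Subtracting \<open>n\<close> from \<open>y\<close> moves the increment into
      \<open>U (Suc k)\<close> and changes neither the class of \<open>y\<close> nor the seminorm of
      the increment.\<close>
    then obtain n where n: "n \<in> N" "y - x - n \<in> U (Suc k)"
      using s(2)[of "y - x" k] t(2)[of k] by auto
    have "y - n \<in> D"
      using y n by (simp add: D_intros N_subset_D)
    moreover have "y +o N = (y - n) +o N"
      using n by (simp add: coset_eq_iff)
    moreover have "(y - n) - x \<in> U (Suc k)"
      using n(2) by (simp add: algebra_simps)
    moreover have "snorm ((y - n) - x) < t k"
      using snorm_add_N[OF xy(2) N_intros(5)[OF n(1)]] xy(1) by (simp add: algebra_simps)
    ultimately show "\<exists>x'. (x' \<in> D \<and> \<sigma> (r (Suc k)) = x' +o N) \<and>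
        (x' - x \<in> U (Suc k) \<and> snorm (x' - x) < t k)"
      using y(2) by metis
  qed
  then obtain x where x: "\<And>k. x k \<in> D" "\<And>k. \<sigma> (r k) = x k +o N"
    "\<And>k. x (Suc k) - x k \<in> U (Suc k)" "\<And>k. snorm (x (Suc k) - x k) < t k"
    by blast
  have "snorm (x (Suc k) - x k) \<le> (1/2) ^ k" for k
    using x(4)[of k] t(3)[of k] by linarith
  then obtain l where l: "l \<in> D" "limitin (form_topology T q) x l sequentially"
    using fast_Cauchy_converges[OF closed U x(1,3)] by blast
  have "\<forall>\<^sub>F n in sequentially. snorm (x n - l) < e" if "0 < e" for e
  proof -
    have "\<forall>\<^sub>F n in sequentially. x n \<in> D \<and> x n - l \<in> UNIV \<and> snorm (x n - l) < e"
      using l(2) nbhd_UNIV that unfolding limitin_form_topology_iff by blast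
    then show ?thesis
      by (rule eventually_mono) simp
  qed
  then have "limitin quot.mtopology (\<lambda>k. x k +o N) (l +o N) sequentially"
    using x(1) l(1) by (simp add: limitin_coset_iff)
  then have "limitin quot.mtopology (\<sigma> \<circ> r) (l +o N) sequentially"
    by (simp add: o_def x(2))
  then show "\<exists>A. limitin quot.mtopology \<sigma> A sequentially"
    using quot.MCauchy_convergent_subsequence[OF Cauchy mono] by blast
qed

text \<open>Passes from completeness for sequences to filters: a single seminorm needs only the
  radii \<open>(1/2) ^ n\<close>, so a sequence of centres \<open>c n\<close> represents the
  filter.\<close>

lemma seminorm_Cauchy_filter_converges:
  assumes complete: "quot.mcomplete" and F: "F \<noteq> bot" "\<forall>\<^sub>F x in F. x \<in> D"
    and Cauchy: "\<And>e. 0 < e \<Longrightarrow> \<forall>\<^sub>F (x, y) in F \<times>\<^sub>F F. snorm (x - y) < e"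
  obtains u where "u \<in> D" "\<And>e. 0 < e \<Longrightarrow> \<forall>\<^sub>F x in F. snorm (x - u) < e"
proof -
  have "\<exists>c\<in>D. \<forall>\<^sub>F y in F. snorm (y - c) < e" if e: "0 < e" for e
  proof -
    obtain P Q where PQ: "eventually P F" "eventually Q F"
      "\<And>x y. P x \<Longrightarrow> Q y \<Longrightarrow> snorm (x - y) < e"
      using Cauchy[OF e] unfolding eventually_prod_filter by auto
    obtain c where "Q c" "c \<in> D"
      using eventually_happens'[OF F(1) eventually_conj[OF PQ(2) F(2)]] by blast
    then show ?thesis
      using PQ by (intro bexI[of _ c]) (auto elim: eventually_mono)
  qed
  then have "\<exists>c\<in>D. \<forall>\<^sub>F y in F. snorm (y - c) < (1/2) ^ n" for n
    by simp
  then obtain c where c: "\<And>n. c n \<in> D" "\<And>n. \<forall>\<^sub>F y in F. snorm (y - c n) < (1/2) ^ n"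
    by metis
  \<comment> \<open>As \<open>F\<close> is proper, the balls around \<open>c m\<close> and
    \<open>c n\<close> have a common point \<open>y\<close>.\<close>
  have cc: "snorm (c m - c n) < (1/2) ^ m + (1/2) ^ n" for m n
  proof -
    obtain y where y: "snorm (y - c m) < (1/2) ^ m" "snorm (y - c n) < (1/2) ^ n" "y \<in> D"
      using eventually_happens'[OF F(1) eventually_conj[OF eventually_conj[OF c(2)[of m] c(2)[of n]] F(2)]]
      by blast
    then show ?thesis
      using snorm_triangle_via[OF c(1)[of m] y(3) c(1)[of n]] by (simp add: snorm_minus_commute)
  qed
  have small: "\<exists>M. \<forall>n\<ge>M. (1/2::real) ^ n < e" if e: "0 < e" for e
  proof -
    obtain M where "(1/2::real) ^ M < e"
      using real_arch_pow_inv[OF e, of "1/2"] by auto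
    moreover have "(1/2::real) ^ n \<le> (1/2) ^ M" if "M \<le> n" for n
      using that by (intro power_decreasing) auto
    ultimately show ?thesis
      by (meson le_less_trans)
  qed
  have "quot.MCauchy (\<lambda>n. c n +o N)"
    unfolding MCauchy_coset_iff[OF c(1)]
  proof (intro allI impI)
    fix e :: real assume "0 < e"
    then obtain M where M: "\<And>n. M \<le> n \<Longrightarrow> (1/2::real) ^ n < e / 2"
      using small[of "e / 2"] half_gt_zero by blast
    have "snorm (c m - c n) < e" if "M \<le> m" "M \<le> n" for m n
      using cc[of m n] M[OF that(1)] M[OF that(2)] by linarith
    then show "\<exists>M. \<forall>m\<ge>M. \<forall>n\<ge>M. snorm (c m - c n) < e"
      by blast
  qed
  then obtain A where A: "limitin quot.mtopology (\<lambda>n. c n +o N) A sequentially"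
    using complete unfolding quot.mcomplete_def by blast
  then have "A \<in> form_quotient q"
    by (simp add: quot.limitin_metric)
  then obtain u where u: "u \<in> D" "A = u +o N"
    by (rule form_quotient_cases)
  have cu: "\<forall>\<^sub>F n in sequentially. snorm (c n - u) < e" if "0 < e" for e
    using A that limitin_coset_iff[where u = c, OF c(1) u(1)] u(2) by blast
  have "\<forall>\<^sub>F x in F. snorm (x - u) < e" if e: "0 < e" for e
  proof -
    have e2: "0 < e / 2"
      using e by simp
    obtain M where M: "\<And>n. M \<le> n \<Longrightarrow> (1/2::real) ^ n < e / 2"
      using small[OF e2] by blast
    obtain K where K: "\<And>n. K \<le> n \<Longrightarrow> snorm (c n - u) < e / 2"
      using cu[OF e2] unfolding eventually_sequentially by blast
    define n where "n = max M K"
    show ?thesis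
      using c(2)[of n] F(2)
    proof eventually_elim
      case (elim x)
      then show ?case
        using snorm_triangle_via[OF elim(2) c(1)[of n] u(1)] M[of n] K[of n] by (simp add: n_def)
    qed
  qed
  with u(1) show thesis
    by (rule that)
qed

text \<open>The \<open>T\<close>-limit \<open>v\<close> and the \<open>q\<close>-limit \<open>u\<close> of a filter have the same class, because the embedding
  is continuous and \<open>N\<close> is closed; hence \<open>v\<close> is a limit in the form topology.\<close>

lemma embedding_continuous_hilbert_imp_closed:
  assumes T_complete: "vector_complete T" and N_closed: "closedin T N"
    and emb: "form_embedding_continuous T q" and complete: "quot.mcomplete"
  shows "closed_form T q"
  unfolding closed_form_def vector_complete_def
proof (intro allI impI)
  fix F assume FD: "F \<le> principal (topspace (form_topology T q))" and F: "F \<noteq> bot"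
    and Cauchy: "vector_cauchy_filter (form_topology T q) F"
  have D: "\<forall>\<^sub>F x in F. x \<in> D"
    using FD by (simp add: le_principal topspace_form_topology)
  have C: "\<forall>\<^sub>F (x, y) in F \<times>\<^sub>F F. x - y \<in> D \<and> x - y \<in> W \<and> snorm (x - y) < e"
    if "nbhd W" "0 < e" for W e
    using Cauchy that unfolding vector_cauchy_filter_form_topology_iff by blast
  have "vector_cauchy_filter T F"
    unfolding vector_cauchy_filter_def
  proof (intro allI impI)
    fix W assume "openin T W \<and> 0 \<in> W"
    then have "nbhd W"
      by (simp add: nbhd_def)
    from C[OF this zero_less_one] show "\<forall>\<^sub>F (x, y) in F \<times>\<^sub>F F. x - y \<in> W"
      by (rule eventually_mono) auto
  qed
  moreover have "F \<le> principal (topspace T)"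
    by simp
  ultimately obtain v where "limitin T (\<lambda>x. x) v F"
    using T_complete F unfolding vector_complete_def by blast
  then have v: "\<forall>\<^sub>F x in F. x - v \<in> W" if "nbhd W" for W
    using that by (simp add: limitin_iff_nbhd)
  have "\<forall>\<^sub>F (x, y) in F \<times>\<^sub>F F. snorm (x - y) < e" if "0 < e" for e
    using C[OF nbhd_UNIV that] by (rule eventually_mono) auto
  then obtain u where u: "u \<in> D" "\<And>e. 0 < e \<Longrightarrow> \<forall>\<^sub>F x in F. snorm (x - u) < e"
    using seminorm_Cauchy_filter_converges[OF complete F D] by blast
  have "v - u \<in> N"
  proof (rule approx_if_closedin[OF N_closed])
    fix W assume "nbhd W"
    then obtain W' where W': "nbhd W'" "\<And>x. x \<in> W' \<Longrightarrow> - x \<in> W'"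
      "\<And>x y. x \<in> W' \<Longrightarrow> y \<in> W' \<Longrightarrow> x + y \<in> W"
      using nbhd_half by blast
    obtain e where e: "e > 0" "\<And>z. z \<in> D \<Longrightarrow> snorm z < e \<Longrightarrow> \<exists>n\<in>N. z - n \<in> W'"
      using emb W'(1) unfolding form_embedding_continuous_iff by blast
    obtain x where x: "x - v \<in> W'" "snorm (x - u) < e" "x \<in> D"
      using eventually_happens'[OF F eventually_conj[OF eventually_conj[OF v[OF W'(1)] u(2)[OF e(1)]] D]]
      by blast
    then obtain n where n: "n \<in> N" "x - u - n \<in> W'"
      using e(2)[of "x - u"] u(1) by (auto simp: D_intros)
    \<comment> \<open>The point \<open>x\<close> of the filter cancels: this element is
      \<open>n - (v - u)\<close>, so \<open>v - u\<close> is approximated by kernel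
      elements.\<close>
    have "(x - v) + - (x - u - n) \<in> W"
      using x n by (intro W')
    with n(1) show "\<exists>n\<in>N. n - (v - u) \<in> W"
      by (intro bexI[of _ n]) (auto simp: algebra_simps)
  qed
  then have vD: "v \<in> D" and vu: "u - v \<in> N"
    using D_add_diff(1)[of "v - u" u] N_intros(5)[of "v - u"] u(1) by (auto simp: N_subset_D)
  have "\<forall>\<^sub>F x in F. x \<in> D \<and> x - v \<in> W \<and> snorm (x - v) < e" if "nbhd W" "0 < e" for W e
    using D v[OF that(1)] u(2)[OF that(2)]
  proof eventually_elim
    case (elim x)
    have "snorm (x - v) = snorm (x - u)"
      using snorm_add_N[OF D_add_diff(2)[OF elim(1) u(1)] vu] by simp
    with elim show ?case by simp
  qed
  with vD have "limitin (form_topology T q) (\<lambda>x. x) v F"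
    by (simp add: limitin_form_topology_iff)
  then show "\<exists>l. limitin (form_topology T q) (\<lambda>x. x) l F"
    by blast
qed

end

theorem theorem1p38:
  fixes \<tau> :: "'v::real_vector topology" and q :: "'v \<Rightarrow> ennreal"
  assumes "topological_vector_space \<tau>"
    and "vector_complete \<tau>"
    and "quadratic_form q"
    and "metrizable_space (form_topology \<tau> q)"
  shows
    "(closed_form \<tau> q \<and>
        (closedin \<tau> (form_kernel q) \<and> form_embedding_continuous \<tau> q)
        \<longrightarrow> form_quotient_hilbert q) \<and>
     (closed_form \<tau> q \<and> form_quotient_hilbert q
        \<longrightarrow> closedin \<tau> (form_kernel q) \<and> form_embedding_continuous \<tau> q) \<and>
     ((closedin \<tau> (form_kernel q) \<and> form_embedding_continuous \<tau> q) \<and>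
        form_quotient_hilbert q
        \<longrightarrow> closed_form \<tau> q)"
proof -
  interpret tvs_quadratic_form \<tau> q
    using assms(1,3) by unfold_locales
  show ?thesis
    unfolding form_quotient_hilbert_iff
    using closed_embedding_continuous_imp_hilbert kernel_closedin
      closed_hilbert_imp_embedding_continuous embedding_continuous_hilbert_imp_closed
      assms(2,4) by blast
qed

end
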